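(* Let $m\geq 1$ be an integer. For $R\in(0,+\infty)$ let $\xi_{(m)}=\xi_{(m)}(R)$ be the $m$th eigenvalue (without counting multiplicity) of the first fourth-order Steklov problem on the closed geodesic disk of radius $R$ in the $2$-dimensional hyperbolic space $\mathbb{H}^2$. Then, as functions of $R$: (1) $\xi_{(m)}R^3$ is strictly decreasing on $(0,+\infty)$; (2) $\xi_{(m)}\sinh^3 R$ is strictly increasing on $(0,+\infty)$; (3) $\xi_{(m)}\tanh^3(R/2)$ is strictly decreasing on $(0,+\infty)$; (4) $\xi_{(m)}\sinh^3(R/2)$ is strictly decreasing on $(0,+\infty)$.
   Context: The hyperbolic space $\mathbb{H}^2$ has constant curvature $-1$; the geodesic disk of radius $R$ carries the metric $dr^2+\sinh^2 r\, g_{\mathbb{S}^1}$, $0\le r\le R$, where $r$ is the distance to the center. First fourth-order Steklov problem: on a smooth compact Riemannian manifold $M$ with boundary $\partial M$ and outward unit normal $\nu$, a real number $\xi$ is an eigenvalue if there is a nontrivial $u$ with $$\Delta^2 u=0 \text{ in } M,\qquad \frac{\partial u}{\partial\nu}=0,\quad \frac{\partial(\Delta u)}{\partial\nu}+\xi u=0 \text{ on } \partial M,$$ where $\Delta$ is the Laplace--Beltrami operator ($\Delta=\operatorname{div}\nabla$). The spectrum is discrete, nonnegative and unbounded; the distinct eigenvalues (without counting multiplicity) are listed in increasing order as $0=\xi_{(0)}<\xi_{(1)}<\xi_{(2)}<\cdots$. *)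

theory Defs
  imports "HOL-Analysis.Analysis"
begin

section \<open>Smooth functions on open subsets of Euclidean space\<close>

definition pderiv_at :: "'n \<Rightarrow> (real^'n \<Rightarrow> real) \<Rightarrow> real^'n \<Rightarrow> real" where
  "pderiv_at i f x = frechet_derivative f (at x) (axis i 1)"

primrec Ck_on :: "nat \<Rightarrow> (real^'n) set \<Rightarrow> (real^'n \<Rightarrow> real) \<Rightarrow> bool" where
  "Ck_on 0 S f = continuous_on S f"
| "Ck_on (Suc k) S f =
     ((\<forall>x\<in>S. f differentiable (at x)) \<and> (\<forall>i. Ck_on k S (pderiv_at i f)))"

definition smooth_on :: "(real^'n) set \<Rightarrow> (real^'n \<Rightarrow> real) \<Rightarrow> bool" where
  "smooth_on S f \<longleftrightarrow> (\<forall>k. Ck_on k S f)"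


section \<open>Riemannian metrics in a single chart\<close>

text \<open>A metric is given by its coefficient matrix as a function of the coordinates.\<close>

type_synonym 'n metric = "real^'n \<Rightarrow> real^'n^'n"

definition ginner :: "'n::finite metric \<Rightarrow> real^'n \<Rightarrow> real^'n \<Rightarrow> real^'n \<Rightarrow> real" where
  "ginner G x v w = v \<bullet> (G x *v w)"

text \<open>Curves are C1 up to the end points. The weaker notion
  \<open>piecewise_C1_differentiable_on\<close> would admit curves of infinite length, on which the
  integral takes the default value 0.\<close>

definition riem_length :: "'n::finite metric \<Rightarrow> (real \<Rightarrow> real^'n) \<Rightarrow> real" where
  "riem_length G c = integral {0..1}
     (\<lambda>t. sqrt (ginner G (c t) (vector_derivative c (at t)) (vector_derivative c (at t))))"

definition riem_dist ::
  "'n::finite metric \<Rightarrow> (real^'n) set \<Rightarrow> real^'n \<Rightarrow> real^'n \<Rightarrow> real" where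
  "riem_dist G X p q = Inf {riem_length G c | c.
     c C1_differentiable_on {0..1} \<and> c ` {0..1} \<subseteq> X \<and> c 0 = p \<and> c 1 = q}"

definition geodesic_disk ::
  "'n::finite metric \<Rightarrow> (real^'n) set \<Rightarrow> real^'n \<Rightarrow> real \<Rightarrow> (real^'n) set" where
  "geodesic_disk G X p R = {q \<in> X. riem_dist G X p q \<le> R}"

definition riem_grad ::
  "'n::finite metric \<Rightarrow> (real^'n \<Rightarrow> real) \<Rightarrow> real^'n \<Rightarrow> real^'n" where
  "riem_grad G f x = matrix_inv (G x) *v (\<chi> i. pderiv_at i f x)"

definition riem_div ::
  "'n::finite metric \<Rightarrow> (real^'n \<Rightarrow> real^'n) \<Rightarrow> real^'n \<Rightarrow> real" where
  "riem_div G V x =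
     (\<Sum>i\<in>UNIV. pderiv_at i (\<lambda>y. sqrt (det (G y)) * V y $ i) x) / sqrt (det (G x))"

definition laplace_beltrami ::
  "'n::finite metric \<Rightarrow> (real^'n \<Rightarrow> real) \<Rightarrow> real^'n \<Rightarrow> real" where
  "laplace_beltrami G f = riem_div G (riem_grad G f)"

definition tangent_vectors :: "(real^'n) set \<Rightarrow> real^'n \<Rightarrow> (real^'n) set" where
  "tangent_vectors S x =
     {v. \<exists>c. c 0 = x \<and> (\<forall>t. c t \<in> S) \<and> (c has_vector_derivative v) (at (0::real))}"

definition is_outward_unit_normal ::
  "'n::finite metric \<Rightarrow> (real^'n) set \<Rightarrow> real^'n \<Rightarrow> real^'n \<Rightarrow> bool" where
  "is_outward_unit_normal G M x n \<longleftrightarrow>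
     ginner G x n n = 1 \<and>
     (\<forall>v\<in>tangent_vectors (frontier M) x. ginner G x n v = 0) \<and>
     (\<exists>e>0. \<forall>t. 0 < t \<and> t < e \<longrightarrow> x + t *\<^sub>R n \<notin> M)"

definition outward_unit_normal ::
  "'n::finite metric \<Rightarrow> (real^'n) set \<Rightarrow> real^'n \<Rightarrow> real^'n" where
  "outward_unit_normal G M x = (THE n. is_outward_unit_normal G M x n)"

definition normal_deriv ::
  "'n::finite metric \<Rightarrow> (real^'n) set \<Rightarrow> (real^'n \<Rightarrow> real) \<Rightarrow> real^'n \<Rightarrow> real" where
  "normal_deriv G M f x = frechet_derivative f (at x) (outward_unit_normal G M x)"


section \<open>The first fourth-order Steklov problem\<close>

text \<open>\<open>M\<close> is a compact domain with smooth boundary inside the chart. Smoothness of \<open>u\<close> up to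
  the boundary means that \<open>u\<close> is smooth on an open neighbourhood of \<open>M\<close>; the derivatives
  occurring below are determined on \<open>M\<close> by the values of \<open>u\<close> on \<open>M\<close>.\<close>

definition steklov_eigenvalue :: "'n::finite metric \<Rightarrow> (real^'n) set \<Rightarrow> real \<Rightarrow> bool" where
  "steklov_eigenvalue G M \<xi> \<longleftrightarrow>
     (\<exists>u U. open U \<and> M \<subseteq> U \<and> smooth_on U u \<and>
        (\<exists>x\<in>M. u x \<noteq> 0) \<and>
        (\<forall>x\<in>M. laplace_beltrami G (laplace_beltrami G u) x = 0) \<and>
        (\<forall>x\<in>frontier M. normal_deriv G M u x = 0) \<and>
        (\<forall>x\<in>frontier M. normal_deriv G M (laplace_beltrami G u) x + \<xi> * u x = 0))"

text \<open>The \<open>m\<close>-th element, counted from 0, of the increasing list of distinct eigenvalues.\<close>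

definition nth_steklov_eigenvalue :: "'n::finite metric \<Rightarrow> (real^'n) set \<Rightarrow> nat \<Rightarrow> real" where
  "nth_steklov_eigenvalue G M m =
     (THE \<xi>. steklov_eigenvalue G M \<xi> \<and>
        finite {\<eta>. steklov_eigenvalue G M \<eta> \<and> \<eta> < \<xi>} \<and>
        card {\<eta>. steklov_eigenvalue G M \<eta> \<and> \<eta> < \<xi>} = m)"


section \<open>The hyperbolic plane\<close>

text \<open>The Poincare model: the open unit disk with the metric
  \<open>4 (dx^2 + dy^2) / (1 - x^2 - y^2)^2\<close> of curvature -1.\<close>

definition hyp_plane :: "(real^2) set" where
  "hyp_plane = ball 0 1"

definition hyp_metric :: "2 metric" where
  "hyp_metric x = mat ((2 / (1 - (norm x)\<^sup>2))\<^sup>2)"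

text \<open>The centre is fixed at the origin, since the isometry group acts transitively.\<close>

definition hyp_disk :: "real \<Rightarrow> (real^2) set" where
  "hyp_disk R = geodesic_disk hyp_metric hyp_plane 0 R"

definition xi :: "nat \<Rightarrow> real \<Rightarrow> real" where
  "xi m R = nth_steklov_eigenvalue hyp_metric (hyp_disk R) m"


subsection \<open>The disk in geodesic polar coordinates\<close>

lemma ginner_hyp:
  "ginner hyp_metric x v w = (2 / (1 - (norm x)\<^sup>2))\<^sup>2 * (v \<bullet> w)"
proof -
  have "mat k *v w = k *\<^sub>R w" for k :: real
    by (simp add: matrix_vector_mult_def mat_def vec_eq_iff if_distrib if_distribR cong: if_cong)
  then show ?thesis by (simp add: ginner_def hyp_metric_def)
qed

text \<open>In polar coordinates the metric is \<open>dr^2 + sinh^2 r d\<theta>^2\<close>.\<close>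

definition hyp_polar :: "real \<Rightarrow> real \<Rightarrow> real^2" where
  "hyp_polar r \<theta> = tanh (r / 2) *\<^sub>R vector [cos \<theta>, sin \<theta>]"

lemma hyp_metric_polar:
  fixes r \<theta> :: real
  obtains a b :: "real^2"
  where "((\<lambda>r. hyp_polar r \<theta>) has_vector_derivative a) (at r)"
    and "((\<lambda>\<theta>. hyp_polar r \<theta>) has_vector_derivative b) (at \<theta>)"
    and "ginner hyp_metric (hyp_polar r \<theta>) a a = 1"
    and "ginner hyp_metric (hyp_polar r \<theta>) a b = 0"
    and "ginner hyp_metric (hyp_polar r \<theta>) b b = (sinh r)\<^sup>2"
proof -
  define s where "s = tanh (r / 2)"
  define a :: "real^2" where "a = ((1 - s\<^sup>2) / 2) *\<^sub>R vector [cos \<theta>, sin \<theta>]"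
  define b :: "real^2" where "b = s *\<^sub>R vector [- sin \<theta>, cos \<theta>]"
  have in2: "vector [p, q] \<bullet> (vector [p', q'] :: real^2) = p * p' + q * q'" for p q p' q' :: real
    by (simp add: inner_vec_def UNIV_2)
  have ax: "vector [p, q] = p *\<^sub>R axis 1 1 + q *\<^sub>R (axis 2 1 :: real^2)" for p q :: real
    by (simp add: vec_eq_iff forall_2 axis_def)
  have ch: "cosh (r / 2) \<noteq> 0" by simp
  have "s\<^sup>2 < 1"
    using tanh_real_bounds[of "r / 2"] by (simp add: s_def abs_square_less_1 abs_less_iff)
  then have s1: "1 - s\<^sup>2 \<noteq> 0" by simp
  have n2: "(norm (hyp_polar r \<theta>))\<^sup>2 = s\<^sup>2"
    by (simp add: hyp_polar_def s_def in2 power_mult_distrib power2_norm_eq_inner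
        flip: power2_eq_square)
  have d1: "((\<lambda>r. hyp_polar r \<theta>) has_vector_derivative a) (at r)"
    unfolding hyp_polar_def a_def s_def
    by (auto intro!: derivative_eq_intros simp: has_real_derivative_iff_has_vector_derivative[symmetric])
  have d2: "((\<lambda>\<theta>. hyp_polar r \<theta>) has_vector_derivative b) (at \<theta>)"
    unfolding hyp_polar_def b_def ax s_def
    by (auto intro!: derivative_eq_intros simp: has_real_derivative_iff_has_vector_derivative[symmetric])
  have "1 - s\<^sup>2 = 1 / (cosh (r / 2))\<^sup>2"
  proof -
    have "1 - s\<^sup>2 = ((cosh (r / 2))\<^sup>2 - (sinh (r / 2))\<^sup>2) / (cosh (r / 2))\<^sup>2"
      using ch by (simp add: s_def tanh_def power_divide diff_divide_distrib)
    then show ?thesis by (simp only: hyperbolic_pythagoras)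
  qed
  then have "2 * s / (1 - s\<^sup>2) = 2 * sinh (r / 2) * cosh (r / 2)"
    using ch by (simp add: s_def tanh_def power2_eq_square)
  also have "\<dots> = sinh r" using sinh_double[of "r / 2"] by simp
  finally have sh: "2 * s / (1 - s\<^sup>2) = sinh r" .
  have g1: "ginner hyp_metric (hyp_polar r \<theta>) a a = 1"
    using s1 by (simp add: ginner_hyp n2 a_def in2 power2_eq_square[symmetric])
       (simp add: power2_eq_square)
  have g2: "ginner hyp_metric (hyp_polar r \<theta>) a b = 0"
    by (simp add: ginner_hyp n2 a_def b_def in2)
  have "ginner hyp_metric (hyp_polar r \<theta>) b b = (2 * s / (1 - s\<^sup>2))\<^sup>2"
    by (simp add: ginner_hyp n2 b_def in2 power2_eq_square[symmetric] power_divide)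
  then have g3: "ginner hyp_metric (hyp_polar r \<theta>) b b = (sinh r)\<^sup>2"
    by (simp add: sh)
  show thesis using that[OF d1 d2 g1 g2 g3] .
qed

lemma riem_length_hyp_ge:
  assumes "c C1_differentiable_on {0..1}" "c ` {0..1} \<subseteq> hyp_plane" "c 0 = 0"
  shows "2 * artanh (norm (c 1)) \<le> riem_length hyp_metric c"
proof -
  obtain D where D: "\<And>t. t \<in> {0..1} \<Longrightarrow> (c has_vector_derivative D t) (at t)"
    and cD: "continuous_on {0..1} D"
    using assms(1) unfolding C1_differentiable_on_def by blast
  have cc: "continuous_on {0..1} c"
    using D by (meson continuous_on_eq_continuous_within has_vector_derivative_continuous
        has_vector_derivative_at_within)
  have c1: "norm (c t) < 1" if "t \<in> {0..1}" for t
    using assms(2) that by (auto simp: hyp_plane_def image_subset_iff)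
  define e where "e = c 1 /\<^sub>R norm (c 1)"
  have e: "norm e \<le> 1" by (cases "c 1 = 0") (simp_all add: e_def)
  have ce: "c 1 \<bullet> e = norm (c 1)"
    by (cases "c 1 = 0") (simp_all add: e_def dot_square_norm power2_eq_square)
  have ine: "\<bar>v \<bullet> e\<bar> \<le> norm v" for v
    using Cauchy_Schwarz_ineq2[of v e] e
    by (meson mult_left_le norm_ge_zero order_trans)
  define f where "f t = 2 * (D t \<bullet> e) / (1 - (c t \<bullet> e)\<^sup>2)" for t
  define g where "g t = 2 * norm (D t) / (1 - (norm (c t))\<^sup>2)" for t
  have sq: "(norm (c t))\<^sup>2 < 1" "(c t \<bullet> e)\<^sup>2 \<le> (norm (c t))\<^sup>2" if "t \<in> {0..1}" for t
    using c1[OF that] ine[of "c t"]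
    by (auto simp: abs_square_less_1 abs_le_square_iff[symmetric])
  have "(f has_integral 2 * artanh (c 1 \<bullet> e) - 2 * artanh (c 0 \<bullet> e)) {0..1}"
  proof (rule fundamental_theorem_of_calculus)
    fix t :: real assume t: "t \<in> {0..1}"
    have "((\<lambda>t. c t \<bullet> e) has_real_derivative (D t \<bullet> e)) (at t within {0..1})"
      using bounded_linear.has_vector_derivative[OF bounded_linear_inner_left
          has_vector_derivative_at_within[OF D[OF t]]]
      by (simp add: has_real_derivative_iff_has_vector_derivative)
    moreover have "\<bar>c t \<bullet> e\<bar> < 1" using ine[of "c t"] c1[OF t] by linarith
    ultimately have "((\<lambda>t. 2 * artanh (c t \<bullet> e)) has_real_derivative
        2 * (1 / (1 - (c t \<bullet> e)\<^sup>2) * (D t \<bullet> e))) (at t within {0..1})"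
      by (intro DERIV_cmult DERIV_chain2[where f = artanh] artanh_real_has_field_derivative)
    then have "((\<lambda>t. 2 * artanh (c t \<bullet> e)) has_real_derivative f t) (at t within {0..1})"
      by (simp add: f_def)
    then show "((\<lambda>t. 2 * artanh (c t \<bullet> e)) has_vector_derivative f t) (at t within {0..1})"
      by (simp add: has_real_derivative_iff_has_vector_derivative)
  qed simp
  then have fi: "(f has_integral 2 * artanh (norm (c 1))) {0..1}"
    using assms(3) by (simp add: ce)
  have "1 - (norm (c t))\<^sup>2 \<noteq> 0" if "t \<in> {0..1}" for t using sq[OF that] by linarith
  then have "continuous_on {0..1} g"
    unfolding g_def by (intro continuous_intros cD cc) auto
  then have gi: "(g has_integral integral {0..1} g) {0..1}"
    by (intro integrable_integral integrable_continuous_real)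
  have "f t \<le> g t" if t: "t \<in> {0..1}" for t
    unfolding f_def g_def
    using sq[OF t] ine[of "D t"] by (intro frac_le) auto
  then have "2 * artanh (norm (c 1)) \<le> integral {0..1} g"
    using has_integral_le[OF fi gi] by blast
  also have "integral {0..1} g = riem_length hyp_metric c"
    unfolding riem_length_def
  proof (rule integral_cong)
    fix t :: real assume t: "t \<in> {0..1}"
    show "g t = sqrt (ginner hyp_metric (c t) (vector_derivative c (at t)) (vector_derivative c (at t)))"
      using sq[OF t] vector_derivative_at[OF D[OF t]]
      by (simp add: g_def ginner_hyp dot_square_norm real_sqrt_mult)
  qed
  finally show ?thesis .
qed

lemma riem_length_hyp_segment:
  assumes "norm x < 1"
  shows "riem_length hyp_metric (\<lambda>t. t *\<^sub>R x) = 2 * artanh (norm x)"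
proof -
  have lt: "\<bar>t * norm x\<bar> < 1" if "t \<in> {0..1}" for t
    using assms that mult_left_le_one_le[of "norm x" t] by (auto simp: abs_mult)
  define f where "f t = 2 * norm x / (1 - (t * norm x)\<^sup>2)" for t
  have "(f has_integral 2 * artanh (1 * norm x) - 2 * artanh (0 * norm x)) {0..1}"
  proof (rule fundamental_theorem_of_calculus)
    fix t :: real assume t: "t \<in> {0..1}"
    have "((\<lambda>t. t * norm x) has_real_derivative norm x) (at t within {0..1})"
      by (auto intro!: derivative_eq_intros)
    with lt[OF t] have "((\<lambda>t. 2 * artanh (t * norm x)) has_real_derivative
        2 * (1 / (1 - (t * norm x)\<^sup>2) * norm x)) (at t within {0..1})"
      by (intro DERIV_cmult DERIV_chain2[where f = artanh] artanh_real_has_field_derivative)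
    then show "((\<lambda>t. 2 * artanh (t * norm x)) has_vector_derivative f t) (at t within {0..1})"
      by (simp add: f_def has_real_derivative_iff_has_vector_derivative)
  qed simp
  then have "integral {0..1} f = 2 * artanh (norm x)" by (simp add: integral_unique)
  moreover have "integral {0..1} f = riem_length hyp_metric (\<lambda>t. t *\<^sub>R x)"
    unfolding riem_length_def
  proof (rule integral_cong)
    fix t :: real assume t: "t \<in> {0..1}"
    have "((\<lambda>t. t *\<^sub>R x) has_vector_derivative x) (at t)"
      by (auto intro!: derivative_eq_intros)
    then have "vector_derivative (\<lambda>t. t *\<^sub>R x) (at t) = x" by (rule vector_derivative_at)
    moreover have "(t * norm x)\<^sup>2 < 1" using lt[OF t] by (simp add: abs_square_less_1)
    ultimately show "f t = sqrt (ginner hyp_metric (t *\<^sub>R x) (vector_derivative (\<lambda>t. t *\<^sub>R x) (at t))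
        (vector_derivative (\<lambda>t. t *\<^sub>R x) (at t)))"
      by (simp add: f_def ginner_hyp dot_square_norm real_sqrt_mult power_mult_distrib)
  qed
  ultimately show ?thesis by simp
qed

lemma riem_dist_hyp:
  assumes "norm x < 1"
  shows "riem_dist hyp_metric hyp_plane 0 x = 2 * artanh (norm x)"
  unfolding riem_dist_def
proof (rule cInf_eq_minimum)
  have "(\<lambda>t. t *\<^sub>R x) C1_differentiable_on {0..1}"
    unfolding C1_differentiable_on_def
    by (rule exI[of _ "\<lambda>_. x"]) (auto intro!: derivative_eq_intros)
  moreover have "(\<lambda>t. t *\<^sub>R x) ` {0..1} \<subseteq> hyp_plane"
    using assms by (auto simp: hyp_plane_def)
      (meson mult_left_le_one_le norm_ge_zero le_less_trans)
  ultimately show "2 * artanh (norm x) \<in> {riem_length hyp_metric c | c.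
     c C1_differentiable_on {0..1} \<and> c ` {0..1} \<subseteq> hyp_plane \<and> c 0 = 0 \<and> c 1 = x}"
    using riem_length_hyp_segment[OF assms] by force
qed (use riem_length_hyp_ge in blast)

lemma hyp_disk_eq:
  assumes "R > 0"
  shows "hyp_disk R = cball 0 (tanh (R / 2))"
proof -
  have "2 * artanh y \<le> R \<longleftrightarrow> y \<le> tanh (R / 2)" if "0 \<le> y" "y < 1" for y :: real
  proof -
    define q where "q = artanh y"
    have "exp (- (2 * q)) = (1 - y) / (1 + y)"
      using that by (simp add: q_def artanh_def exp_minus)
    then have "tanh q = (1 - (1 - y) / (1 + y)) / (1 + (1 - y) / (1 + y))"
      by (simp add: tanh_real_altdef)
    also have "\<dots> = y" using that by (simp add: divide_simps)
    finally have "tanh q = y" .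
    then have "y \<le> tanh (R / 2) \<longleftrightarrow> q \<le> R / 2" by auto
    then show ?thesis by (auto simp: q_def)
  qed
  moreover have "tanh (R / 2) < 1" by (rule tanh_real_lt_1)
  ultimately show ?thesis
    using riem_dist_hyp by (auto simp: hyp_disk_def geodesic_disk_def hyp_plane_def)
qed

lemma outward_unit_normal_hyp:
  assumes "0 < \<rho>" "\<rho> < 1" "norm x = \<rho>"
  shows "is_outward_unit_normal hyp_metric (cball 0 \<rho>) x n \<longleftrightarrow>
         n = ((1 - \<rho>\<^sup>2) / (2 * \<rho>)) *\<^sub>R x"
proof -
  define J :: "real^2" where "J = vector [- x $ 2, x $ 1]"
  define k where "k = (1 - \<rho>\<^sup>2) / (2 * \<rho>)"
  have \<rho>2: "\<rho>\<^sup>2 < 1" using assms by (simp add: abs_square_less_1)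
  then have k: "k > 0" using assms by (simp add: k_def)
  have xx: "x \<bullet> x = \<rho>\<^sup>2" using assms by (simp add: dot_square_norm)
  have x12: "(x $ 1)\<^sup>2 + (x $ 2)\<^sup>2 = \<rho>\<^sup>2"
    using xx by (simp add: inner_vec_def UNIV_2 power2_eq_square)
  have fr: "frontier (cball (0::real^2) \<rho>) = sphere 0 \<rho>"
    using assms by (simp add: frontier_cball)
  have J: "J \<in> tangent_vectors (sphere 0 \<rho>) x"
  proof -
    define c where "c t = cos t *\<^sub>R x + sin t *\<^sub>R J" for t
    have "c t \<bullet> c t = \<rho>\<^sup>2" for t
    proof -
      have "c t \<bullet> c t = ((cos t)\<^sup>2 + (sin t)\<^sup>2) * ((x $ 1)\<^sup>2 + (x $ 2)\<^sup>2)"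
        by (simp add: c_def J_def inner_vec_def UNIV_2 power2_eq_square algebra_simps
            del: sin_cos_squared_add sin_cos_squared_add2 sin_cos_squared_add3)
      then show ?thesis by (simp add: x12)
    qed
    then have "\<forall>t. c t \<in> sphere 0 \<rho>" using assms by (simp add: norm_eq_sqrt_inner)
    moreover have "(c has_vector_derivative J) (at 0)"
      unfolding c_def
      by (auto intro!: derivative_eq_intros simp: has_real_derivative_iff_has_vector_derivative[symmetric])
    moreover have "c 0 = x" by (simp add: c_def)
    ultimately show ?thesis unfolding tangent_vectors_def by blast
  qed
  have tang: "x \<bullet> v = 0" if v: "v \<in> tangent_vectors (sphere 0 \<rho>) x" for v
  proof -
    obtain c where c: "c 0 = x" "\<And>t. c t \<in> sphere 0 \<rho>" "(c has_vector_derivative v) (at (0::real))"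
      using v unfolding tangent_vectors_def by blast
    have "((\<lambda>t. c t \<bullet> c t) has_derivative (\<lambda>h. x \<bullet> (h *\<^sub>R v) + (h *\<^sub>R v) \<bullet> x)) (at 0)"
      using has_derivative_inner[OF c(3)[unfolded has_vector_derivative_def] c(3)[unfolded has_vector_derivative_def]]
      by (simp add: c(1))
    moreover have "(\<lambda>t. c t \<bullet> c t) = (\<lambda>_. \<rho>\<^sup>2)"
      using c(2) by (simp add: fun_eq_iff dot_square_norm)
    ultimately have "((\<lambda>_::real. \<rho>\<^sup>2) has_derivative (\<lambda>h. x \<bullet> (h *\<^sub>R v) + (h *\<^sub>R v) \<bullet> x)) (at 0)"
      by simp
    from has_derivative_unique[OF this has_derivative_const]
    have "x \<bullet> (1 *\<^sub>R v) + (1 *\<^sub>R v) \<bullet> x = 0" by (rule fun_cong)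
    then show ?thesis by (simp add: inner_commute)
  qed
  have out: "norm (x + t *\<^sub>R (l *\<^sub>R x)) = \<bar>1 + t * l\<bar> * \<rho>" for t l
  proof -
    have "x + t *\<^sub>R (l *\<^sub>R x) = (1 + t * l) *\<^sub>R x" by (simp add: algebra_simps)
    then show ?thesis using assms by simp
  qed
  show ?thesis unfolding k_def[symmetric]
  proof
    assume n: "n = k *\<^sub>R x"
    have "ginner hyp_metric x n n = 1"
      using assms \<rho>2 by (simp add: ginner_hyp n xx k_def power2_eq_square)
    moreover have "\<forall>v\<in>tangent_vectors (frontier (cball 0 \<rho>)) x. ginner hyp_metric x n v = 0"
      using tang by (simp add: fr ginner_hyp n)
    moreover have "\<forall>t. 0 < t \<and> t < 1 \<longrightarrow> x + t *\<^sub>R n \<notin> cball 0 \<rho>"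
      using k assms by (simp add: n out not_le del: scaleR_scaleR)
    ultimately show "is_outward_unit_normal hyp_metric (cball 0 \<rho>) x n"
      unfolding is_outward_unit_normal_def using zero_less_one by blast
  next
    assume n: "is_outward_unit_normal hyp_metric (cball 0 \<rho>) x n"
    have nn: "(2 / (1 - \<rho>\<^sup>2))\<^sup>2 * (n \<bullet> n) = 1"
      using n assms by (simp add: is_outward_unit_normal_def ginner_hyp)
    have "ginner hyp_metric x n J = 0"
      using n J by (simp add: is_outward_unit_normal_def fr)
    then have "n \<bullet> J = 0" using assms \<rho>2 by (simp add: ginner_hyp)
    then have nJ: "n $ 2 * x $ 1 = n $ 1 * x $ 2"
      by (simp add: J_def inner_vec_def UNIV_2)
    define l where "l = (n \<bullet> x) / \<rho>\<^sup>2"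
    have nx: "n \<bullet> x = n $ 1 * x $ 1 + n $ 2 * x $ 2"
      by (simp add: inner_vec_def UNIV_2)
    have "(n \<bullet> x) * x $ 1 = n $ 1 * ((x $ 1)\<^sup>2 + (x $ 2)\<^sup>2)"
         "(n \<bullet> x) * x $ 2 = n $ 2 * ((x $ 1)\<^sup>2 + (x $ 2)\<^sup>2)"
      unfolding nx using nJ by algebra+
    then have nl: "n = l *\<^sub>R x"
      using assms by (simp add: vec_eq_iff forall_2 l_def x12)
    have "l\<^sup>2 = k\<^sup>2"
      using nn assms \<rho>2 by (simp add: nl xx k_def power2_eq_square field_simps)
    moreover have "l \<ge> 0"
    proof (rule ccontr)
      assume l: "\<not> l \<ge> 0"
      obtain d where d: "d > 0" "\<And>t. 0 < t \<Longrightarrow> t < d \<Longrightarrow> x + t *\<^sub>R n \<notin> cball 0 \<rho>"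
        using n unfolding is_outward_unit_normal_def by blast
      define t where "t = min (d / 2) (1 / \<bar>l\<bar>)"
      have t: "0 < t" "t < d" "t \<le> 1 / \<bar>l\<bar>" using d l by (auto simp: t_def)
      then have "t * \<bar>l\<bar> \<le> 1" using l by (simp add: field_simps)
      moreover have "t * l < 0" using l t by (simp add: mult_pos_neg)
      ultimately have "\<bar>1 + t * l\<bar> \<le> 1" using l by simp
      then have "\<bar>1 + t * l\<bar> * \<rho> \<le> 1 * \<rho>"
        using assms by (intro mult_right_mono) auto
      then have "x + t *\<^sub>R n \<in> cball 0 \<rho>"
        by (simp add: nl out del: scaleR_scaleR)
      then show False using d t by blast
    qed
    ultimately have "l = k" using k by (simp add: power2_eq_iff)
    then show "n = k *\<^sub>R x" using nl by simp
  qed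
qed

end

theory Submission
  imports Defs
begin

text \<open>In the Poincare model the hyperbolic Laplacian is \<open>((1 - |x|\<^sup>2) / 2)\<^sup>2\<close> times the Euclidean one,
  so \<open>\<Delta>\<^sup>2 u = 0\<close> says that \<open>v = \<Delta> u\<close> is harmonic, and the problem separates into Fourier modes.
  In mode \<open>k\<close>, \<open>v = r\<^sup>k cos k\<theta>\<close> and \<open>u = g(r\<^sup>2) r\<^sup>k cos k\<theta>\<close> with \<open>g'(s) = q\<^sub>k(s)\<close>,
  \<open>q\<^sub>k(s) = s\<^sup>-\<^sup>k\<^sup>-\<^sup>1 \<integral>\<^sub>0\<^sup>s t\<^sup>k / (1 - t)\<^sup>2 dt\<close>, and the boundary conditions at \<open>\<rho> = tanh (R/2)\<close>, \<open>s = \<rho>\<^sup>2\<close>, force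
  \<open>\<xi>\<^sub>k = (1 - s) k\<^sup>2 / (4 \<rho>\<^sup>3 q\<^sub>k(s))\<close>, which increases strictly with \<open>k\<close>. That there are no other
  eigenvalues follows by taking Fourier coefficients of an arbitrary eigenfunction on circles: they
  satisfy the radial equations, hence vanish if \<open>\<xi>\<close> is none of the \<open>\<xi>\<^sub>k\<close>.

  Up to constants, \<open>\<xi>\<^sub>k sinh\<^sup>3 (R/2) = 1 / ((1 - s)\<^sup>1\<^sup>/\<^sup>2 q\<^sub>k(s))\<close> and
  \<open>\<xi>\<^sub>k sinh\<^sup>3 R = 1 / ((1 - s)\<^sup>2 q\<^sub>k(s))\<close>, so (4) and (2) amount to \<open>q\<^sub>k/2 < (1 - s) q\<^sub>k' < 2 q\<^sub>k\<close>,
  which holds coefficientwise. Statements (3) and (1) follow from (4), as \<open>1 / cosh (R/2)\<close> and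
  \<open>R / sinh (R/2)\<close> are decreasing.\<close>

section \<open>Calculus of \<open>Ck_on\<close>\<close>

lemma pderiv_atI:
  "(f has_derivative f') (at x) \<Longrightarrow> pderiv_at i f x = f' (axis i 1)"
  unfolding pderiv_at_def by (metis frechet_derivative_at)

lemma frechet_derivative_pderiv_at:
  fixes f :: "real^'n \<Rightarrow> real"
  assumes "f differentiable (at x)"
  shows "frechet_derivative f (at x) h = (\<Sum>i\<in>UNIV. h $ i * pderiv_at i f x)"
proof -
  have lin: "linear (frechet_derivative f (at x))"
    using assms by (rule linear_frechet_derivative)
  have "h = (\<Sum>i\<in>UNIV. (h $ i) *\<^sub>R axis i 1)"
    by (simp add: basis_expansion flip: scalar_mult_eq_scaleR)
  then have "frechet_derivative f (at x) h
      = frechet_derivative f (at x) (\<Sum>i\<in>UNIV. (h $ i) *\<^sub>R axis i 1)" by simp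
  also have "\<dots> = (\<Sum>i\<in>UNIV. h $ i * pderiv_at i f x)"
    by (simp add: linear_sum[OF lin] linear_cmul[OF lin] pderiv_at_def)
  finally show ?thesis .
qed

lemma has_derivative_pderiv_at:
  fixes f :: "real^'n \<Rightarrow> real"
  assumes "f differentiable (at x)"
  shows "(f has_derivative (\<lambda>h. \<Sum>i\<in>UNIV. h $ i * pderiv_at i f x)) (at x)"
proof -
  have "frechet_derivative f (at x) = (\<lambda>h. \<Sum>i\<in>UNIV. h $ i * pderiv_at i f x)"
    using frechet_derivative_pderiv_at[OF assms] by blast
  then show ?thesis using assms by (simp add: frechet_derivative_works)
qed

lemma has_derivative_cong_open:
  assumes "open S" "x \<in> S" "\<And>y. y \<in> S \<Longrightarrow> f y = g y"
  shows "(f has_derivative D) (at x) \<longleftrightarrow> (g has_derivative D) (at x)"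
  using assms has_derivative_transform_within_open by metis

lemma frechet_derivative_cong_open:
  assumes "open S" "x \<in> S" "\<And>y. y \<in> S \<Longrightarrow> f y = g y"
  shows "frechet_derivative f (at x) = frechet_derivative g (at x)"
  unfolding frechet_derivative_def using has_derivative_cong_open[OF assms] by simp

lemma pderiv_at_cong:
  assumes "open S" "x \<in> S" "\<And>y. y \<in> S \<Longrightarrow> f y = g y"
  shows "pderiv_at i f x = pderiv_at i g x"
  unfolding pderiv_at_def using frechet_derivative_cong_open[OF assms] by simp

text \<open>The rules for \<open>pderiv_at\<close> hold only where the functions are differentiable,
  that is on \<open>S\<close>. Openness lets each level of the recursion replace a function by one
  that agrees with it on \<open>S\<close>.\<close>

lemma Ck_on_cong:
  assumes "open S" "\<And>x. x \<in> S \<Longrightarrow> f x = g x"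
  shows "Ck_on k S f \<longleftrightarrow> Ck_on k S g"
  using assms(2)
proof (induction k arbitrary: f g)
  case 0
  then show ?case by (simp cong: continuous_on_cong)
next
  case (Suc k)
  have "f differentiable (at x) \<longleftrightarrow> g differentiable (at x)" if "x \<in> S" for x
    unfolding differentiable_def using has_derivative_cong_open[OF assms(1) that] Suc.prems by metis
  moreover have "Ck_on k S (pderiv_at i f) \<longleftrightarrow> Ck_on k S (pderiv_at i g)" for i
    by (rule Suc.IH) (use pderiv_at_cong[OF assms(1)] Suc.prems in metis)
  ultimately show ?case by simp
qed

lemma Ck_on_SucD: "Ck_on (Suc k) S f \<Longrightarrow> Ck_on k S f"
proof (induction k arbitrary: f)
  case 0
  then show ?case
    by (auto intro!: differentiable_imp_continuous_on differentiable_at_imp_differentiable_on)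
next
  case (Suc k)
  then show ?case by (metis Ck_on.simps(2))
qed

lemma Ck_on_subset: "Ck_on k S f \<Longrightarrow> T \<subseteq> S \<Longrightarrow> Ck_on k T f"
  by (induction k arbitrary: f) (auto intro: continuous_on_subset)

lemma pderiv_at_const [simp]: "pderiv_at i (\<lambda>_. c) = (\<lambda>_. 0)"
  by (rule ext, subst pderiv_atI[OF has_derivative_const]) simp

lemma Ck_on_const: "Ck_on k S (\<lambda>_. c)"
  by (induction k arbitrary: c) auto

lemma pderiv_at_component [simp]: "pderiv_at i (\<lambda>x. x $ j) = (\<lambda>_. axis i 1 $ j)"
  by (rule ext, subst pderiv_atI[OF bounded_linear.has_derivative[OF bounded_linear_vec_nth
        has_derivative_ident]]) simp

lemma Ck_on_component: "Ck_on k S (\<lambda>x. x $ j)"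
proof (cases k)
  case (Suc n)
  then show ?thesis
    by (auto simp: Ck_on_const intro: bounded_linear_imp_differentiable bounded_linear_vec_nth)
qed (auto intro: continuous_intros)

lemma pderiv_at_add:
  fixes f g :: "real^'n \<Rightarrow> real"
  assumes "f differentiable (at x)" "g differentiable (at x)"
  shows "pderiv_at i (\<lambda>x. f x + g x) x = pderiv_at i f x + pderiv_at i g x"
  by (subst pderiv_atI[OF has_derivative_add[OF assms[unfolded frechet_derivative_works]]])
     (simp add: pderiv_at_def)

lemma pderiv_at_mult:
  fixes f g :: "real^'n \<Rightarrow> real"
  assumes "f differentiable (at x)" "g differentiable (at x)"
  shows "pderiv_at i (\<lambda>x. f x * g x) x = f x * pderiv_at i g x + pderiv_at i f x * g x"
  by (subst pderiv_atI[OF has_derivative_mult[OF assms[unfolded frechet_derivative_works]]])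
     (simp add: pderiv_at_def)

lemma Ck_on_add:
  assumes "open S"
  shows "Ck_on k S f \<Longrightarrow> Ck_on k S g \<Longrightarrow> Ck_on k S (\<lambda>x. f x + g x)"
proof (induction k arbitrary: f g)
  case 0
  then show ?case by (auto intro: continuous_intros)
next
  case (Suc k)
  have "Ck_on k S (\<lambda>x. pderiv_at i f x + pderiv_at i g x)" for i
    using Suc by auto
  then have "Ck_on k S (pderiv_at i (\<lambda>x. f x + g x))" for i
    using Suc.prems
    by (subst Ck_on_cong[OF assms, of _ "\<lambda>x. pderiv_at i f x + pderiv_at i g x"]) (auto simp: pderiv_at_add)
  then show ?case using Suc.prems by auto
qed

lemma Ck_on_mult:
  assumes "open S"
  shows "Ck_on k S f \<Longrightarrow> Ck_on k S g \<Longrightarrow> Ck_on k S (\<lambda>x. f x * g x)"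
proof (induction k arbitrary: f g)
  case 0
  then show ?case by (auto intro: continuous_intros)
next
  case (Suc k)
  \<comment> \<open>The product rule leaves one factor undifferentiated; it is of class
    \<open>Suc k\<close> and is lowered to \<open>k\<close> so that the induction hypothesis
    applies.\<close>
  have "Ck_on k S (\<lambda>x. f x * pderiv_at i g x + pderiv_at i f x * g x)" for i
    using Suc.prems Ck_on_SucD[of k S] by (intro Ck_on_add assms Suc.IH) auto
  then have "Ck_on k S (pderiv_at i (\<lambda>x. f x * g x))" for i
    using Suc.prems
    by (subst Ck_on_cong[OF assms, of _ "\<lambda>x. f x * pderiv_at i g x + pderiv_at i f x * g x"]) (auto simp: pderiv_at_mult)
  then show ?case using Suc.prems by auto
qed

lemma Ck_on_diff:
  assumes "open S" "Ck_on k S f" "Ck_on k S g"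
  shows "Ck_on k S (\<lambda>x. f x - g x)"
  using Ck_on_add[OF assms(1,2) Ck_on_mult[OF assms(1) Ck_on_const[of _ _ "-1"] assms(3)]] by simp

lemma pderiv_at_diff:
  fixes f g :: "real^'n \<Rightarrow> real"
  assumes "f differentiable (at x)" "g differentiable (at x)"
  shows "pderiv_at i (\<lambda>x. f x - g x) x = pderiv_at i f x - pderiv_at i g x"
  by (subst pderiv_atI[OF has_derivative_diff[OF assms[unfolded frechet_derivative_works]]])
     (simp add: pderiv_at_def)

lemma differentiable_component: "(\<lambda>x::real^'n. x $ i) differentiable (at x)"
  by (rule bounded_linear_imp_differentiable) (rule bounded_linear_vec_nth)

section \<open>Functions of the squared norm\<close>

lemma has_derivative_radial:
  fixes x :: "real^'n"
  assumes "(g has_real_derivative g') (at (x \<bullet> x))"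
  shows "((\<lambda>x. g (x \<bullet> x)) has_derivative (\<lambda>h. g' * (2 * (x \<bullet> h)))) (at x)"
proof -
  have "((\<lambda>x. x \<bullet> x) has_derivative (\<lambda>h. 2 * (x \<bullet> h))) (at x)"
    by (auto intro!: derivative_eq_intros simp: inner_commute)
  from has_derivative_compose[OF this assms[unfolded has_field_derivative_def]]
  show ?thesis by simp
qed

lemma pderiv_at_radial:
  fixes x :: "real^'n"
  assumes "(g has_real_derivative g') (at (x \<bullet> x))"
  shows "pderiv_at i (\<lambda>x. g (x \<bullet> x)) x = g' * (2 * x $ i)"
  by (subst pderiv_atI[OF has_derivative_radial[OF assms]]) (simp add: inner_axis)

text \<open>\<open>G\<close> is a tower of successive derivatives. The partial derivative of
  \<open>G n (x \<bullet> x)\<close> is \<open>G (Suc n) (x \<bullet> x)\<close> times the linear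
  function \<open>2 * x $ i\<close>, so the induction on \<open>k\<close> runs over all members of
  the tower at once.\<close>

lemma Ck_on_radial:
  fixes S :: "(real^'n) set"
  assumes "open S"
    and G: "\<And>n x. x \<in> S \<Longrightarrow> (G n has_real_derivative G (Suc n) (x \<bullet> x)) (at (x \<bullet> x))"
  shows "Ck_on k S (\<lambda>x. G n (x \<bullet> x))"
proof (induction k arbitrary: n)
  case 0
  have "(\<lambda>x. G n (x \<bullet> x)) differentiable (at x)" if "x \<in> S" for x
    using has_derivative_radial[OF G[OF that]] unfolding differentiable_def by blast
  then show ?case
    by (auto intro!: differentiable_imp_continuous_on differentiable_at_imp_differentiable_on)
next
  case (Suc k)
  have "(\<lambda>x. G n (x \<bullet> x)) differentiable (at x)" if "x \<in> S" for x
    using has_derivative_radial[OF G[OF that]] unfolding differentiable_def by blast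
  moreover have "Ck_on k S (\<lambda>x. G (Suc n) (x \<bullet> x) * (2 * x $ i))" for i
    by (intro Ck_on_mult[OF assms(1)] Suc.IH Ck_on_const Ck_on_component)
  then have "Ck_on k S (pderiv_at i (\<lambda>x. G n (x \<bullet> x)))" for i
    by (subst Ck_on_cong[OF assms(1), of _ "\<lambda>x. G (Suc n) (x \<bullet> x) * (2 * x $ i)"])
       (auto simp: pderiv_at_radial[OF G])
  ultimately show ?case by simp
qed

section \<open>The radial power series\<close>

lemma summable_bounded_coeffs:
  fixes c :: "nat \<Rightarrow> real"
  assumes "\<And>n. \<bar>c n\<bar> \<le> B" "norm s < 1"
  shows "summable (\<lambda>n. c n * s ^ n)"
proof (rule summable_comparison_test')
  show "summable (\<lambda>n. B * norm s ^ n)"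
    using assms(2) by (intro summable_mult summable_geometric) simp
  show "norm (c n * s ^ n) \<le> B * norm s ^ n" for n
    using assms(1)[of n] by (simp add: abs_mult power_abs mult_right_mono)
qed

text \<open>Termwise differentiation preserves convergence on the open unit disk, so it can be
  iterated. This supplies the tower that \<open>Ck_on_radial\<close> asks for.\<close>

lemma powser_tower_has_derivative:
  fixes c :: "nat \<Rightarrow> real"
  assumes "\<And>s. norm s < 1 \<Longrightarrow> summable (\<lambda>n. c n * s ^ n)" "norm s < 1"
  shows "((\<lambda>s. \<Sum>n. (diffs ^^ k) c n * s ^ n) has_real_derivative
          (\<Sum>n. (diffs ^^ Suc k) c n * s ^ n)) (at s)"
proof -
  have "summable (\<lambda>n. (diffs ^^ k) c n * s ^ n)" if "norm s < 1" for s
    using that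
  proof (induction k arbitrary: s)
    case 0
    then show ?case using assms(1) by simp
  next
    case (Suc k)
    then show ?case using termdiff_converges[OF Suc.prems Suc.IH] by simp
  qed
  then show ?thesis using termdiffs_strong'[OF _ assms(2)] by simp
qed

text \<open>The coefficients of \<open>q\<^sub>k(s) = s\<^sup>-\<^sup>k\<^sup>-\<^sup>1 \<integral>\<^sub>0\<^sup>s t\<^sup>k / (1 - t)\<^sup>2 dt\<close>. The power series is
  used instead of the integral because it is smooth at \<open>s = 0\<close> by construction.\<close>

definition qcoeff :: "nat \<Rightarrow> nat \<Rightarrow> real" where
  "qcoeff k j = (real j + 1) / (real k + real j + 1)"

definition qser :: "nat \<Rightarrow> real \<Rightarrow> real" where
  "qser k s = (\<Sum>j. qcoeff k j * s ^ j)"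

definition qser' :: "nat \<Rightarrow> real \<Rightarrow> real" where
  "qser' k s = (\<Sum>j. diffs (qcoeff k) j * s ^ j)"

lemma qcoeff_pos: "qcoeff k j > 0"
  by (simp add: qcoeff_def add_nonneg_pos)

lemma qser_sums:
  assumes "norm s < 1"
  shows "(\<lambda>j. qcoeff k j * s ^ j) sums qser k s"
proof -
  have "\<bar>qcoeff k n\<bar> \<le> 1" for n by (simp add: qcoeff_def)
  then show ?thesis unfolding qser_def
    by (intro summable_sums summable_bounded_coeffs[of _ 1] assms)
qed

text \<open>In the second form the factor \<open>s\<close> absorbs the index shift, so that the term
  with \<open>s ^ j\<close> contains \<open>qcoeff k j\<close> and can be combined termwise with the
  series of \<open>qser\<close>.\<close>

lemma qser'_sums:
  assumes "norm s < 1"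
  shows "(\<lambda>j. (real j + 1) * qcoeff k (Suc j) * s ^ j) sums qser' k s"
    and "(\<lambda>j. real j * qcoeff k j * s ^ j) sums (s * qser' k s)"
proof -
  have sm: "summable (\<lambda>j. diffs (qcoeff k) j * s ^ j)"
    using termdiff_converges[OF assms] qser_sums sums_summable by blast
  have d: "diffs (qcoeff k) j = (real j + 1) * qcoeff k (Suc j)" for j
    by (simp add: diffs_def add.commute)
  show "(\<lambda>j. (real j + 1) * qcoeff k (Suc j) * s ^ j) sums qser' k s"
    using summable_sums[OF sm] by (simp add: qser'_def d)
  have "real j * qcoeff k j * s ^ j = s * (of_nat j * qcoeff k j * s ^ (j - Suc 0))" for j
    by (cases j) simp_all
  then show "(\<lambda>j. real j * qcoeff k j * s ^ j) sums (s * qser' k s)"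
    using sums_mult[OF diffs_equiv[OF sm], of s] by (simp only: qser'_def)
qed

lemma qser_has_derivative:
  assumes "norm s < 1"
  shows "(qser k has_real_derivative qser' k s) (at s)"
  unfolding qser_def [abs_def] qser'_def
  by (rule termdiffs_strong'[OF _ assms]) (use qser_sums sums_summable in blast)

text \<open>As \<open>(k + j + 1) * qcoeff k j = j + 1\<close>, the left side sums to the derivative
  of the geometric series. Multiplied by \<open>s ^ k\<close>, the equation says that
  \<open>s ^ (k + 1) * qser k s\<close> is an antiderivative of
  \<open>s ^ k / (1 - s)\<^sup>2\<close>, which is the integral formula for
  \<open>q\<^sub>k\<close>.\<close>

lemma qser_ode:
  assumes "norm s < 1"
  shows "s * qser' k s + (real k + 1) * qser k s = 1 / (1 - s)\<^sup>2"
proof -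
  have "(\<lambda>j. real j * qcoeff k j * s ^ j + (real k + 1) * (qcoeff k j * s ^ j))
      sums (s * qser' k s + (real k + 1) * qser k s)"
    by (intro sums_add sums_mult qser'_sums qser_sums assms)
  moreover have "real j * qcoeff k j * s ^ j + (real k + 1) * (qcoeff k j * s ^ j)
      = of_nat (Suc j) * s ^ j" for j
  proof -
    have "(real k + real j + 1) * qcoeff k j = real j + 1"
      unfolding qcoeff_def by (simp add: add_nonneg_eq_0_iff)
    then have "(real k + real j + 1) * qcoeff k j * s ^ j = (real j + 1) * s ^ j" by simp
    then show ?thesis by (simp add: algebra_simps)
  qed
  ultimately show ?thesis
    using geometric_deriv_sums[OF assms] sums_unique2 by simp
qed

lemma sums_pos_powser:
  fixes c :: "nat \<Rightarrow> real"
  assumes "(\<lambda>j. c j * s ^ j) sums S" "s > 0" "\<And>j. c j > 0"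
  shows "S > 0"
  using suminf_pos[of "\<lambda>j. c j * s ^ j"] assms by (simp add: sums_iff)

lemma qser_pos: "0 < s \<Longrightarrow> s < 1 \<Longrightarrow> qser k s > 0"
  using sums_pos_powser[OF qser_sums _ qcoeff_pos, of s] by simp

lemma qser_antimono_index:
  assumes "0 < s" "s < 1" "k < l"
  shows "qser l s < qser k s"
proof -
  have "(\<lambda>j. (qcoeff k j - qcoeff l j) * s ^ j) sums (qser k s - qser l s)"
    using sums_diff[OF qser_sums qser_sums] assms by (simp add: algebra_simps)
  moreover have "qcoeff k j - qcoeff l j > 0" for j
    using assms by (simp add: qcoeff_def divide_strict_left_mono add_nonneg_pos)
  ultimately show ?thesis using sums_pos_powser[of "\<lambda>j. qcoeff k j - qcoeff l j"] assms(1) by fastforce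
qed

text \<open>Subtracting the two forms of \<open>qser'_sums\<close> shows that the coefficients of
  \<open>(1 - s) * qser' k s\<close> are \<open>(j + 1) * qcoeff k (j + 1) - j * qcoeff k j\<close>.
  Compared with \<open>qcoeff k j / 2\<close> and with \<open>2 * qcoeff k j\<close>, they leave
  differences that are positive once brought over a common denominator.\<close>

lemma qser'_bounds:
  assumes "0 < s" "s < 1"
  shows "qser k s / 2 < (1 - s) * qser' k s" and "(1 - s) * qser' k s < 2 * qser k s"
proof -
  have n: "norm s < 1" using assms by simp
  have 1: "(\<lambda>j. ((real j + 1) * qcoeff k (Suc j) - real j * qcoeff k j) * s ^ j)
      sums ((1 - s) * qser' k s)"
    using sums_diff[OF qser'_sums[OF n]] by (simp add: algebra_simps)
  have p: "real k + real j + 1 > 0" "real k + real j + 2 > 0" for j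
    by (simp_all add: add_nonneg_pos)
  have qc: "qcoeff k j = (real j + 1) / (real k + real j + 1)"
    "qcoeff k (Suc j) = (real j + 2) / (real k + real j + 2)" for j
    by (simp_all add: qcoeff_def add.commute add.left_commute)
  have "(\<lambda>j. ((real j + 1) * qcoeff k (Suc j) - real j * qcoeff k j - 1 / 2 * qcoeff k j) * s ^ j)
      sums ((1 - s) * qser' k s - 1 / 2 * qser k s)"
    using sums_diff[OF 1 sums_mult[OF qser_sums[OF n], of "1 / 2"]] by (simp add: algebra_simps)
  moreover have "(real j + 1) * qcoeff k (Suc j) - real j * qcoeff k j - 1 / 2 * qcoeff k j > 0" for j
  proof -
    have "(real j + 1) * qcoeff k (Suc j) - real j * qcoeff k j - 1 / 2 * qcoeff k j
       = (real j + 1) * (3 * real k / 2 + real j / 2 + 1) / ((real k + real j + 1) * (real k + real j + 2))"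
      unfolding qc using p[of j] by (simp add: divide_simps) algebra
    also have "\<dots> > 0" using p[of j] by (intro divide_pos_pos mult_pos_pos) auto
    finally show ?thesis .
  qed
  ultimately show "qser k s / 2 < (1 - s) * qser' k s"
    using sums_pos_powser[OF _ assms(1)] by fastforce
  have "(\<lambda>j. (2 * qcoeff k j - ((real j + 1) * qcoeff k (Suc j) - real j * qcoeff k j)) * s ^ j)
      sums (2 * qser k s - (1 - s) * qser' k s)"
    using sums_diff[OF sums_mult[OF qser_sums[OF n], of 2] 1] by (simp add: algebra_simps)
  moreover have "2 * qcoeff k j - ((real j + 1) * qcoeff k (Suc j) - real j * qcoeff k j) > 0" for j
  proof -
    have "2 * qcoeff k j - ((real j + 1) * qcoeff k (Suc j) - real j * qcoeff k j)
       = (real j + 1) * (real j + 2) / ((real k + real j + 1) * (real k + real j + 2))"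
      unfolding qc using p[of j] by (simp add: divide_simps) algebra
    also have "\<dots> > 0" using p[of j] by (intro divide_pos_pos mult_pos_pos) auto
    finally show ?thesis .
  qed
  ultimately show "(1 - s) * qser' k s < 2 * qser k s"
    using sums_pos_powser[OF _ assms(1)] by fastforce
qed

section \<open>Monotonicity of the explicit eigenvalues\<close>

text \<open>The value \<open>\<xi>\<^sub>k\<close> belonging to Fourier mode \<open>k\<close>, in
  terms of the Euclidean radius \<open>\<rho>\<close> of the disk. Mode 0 gives 0, so the modes and
  the distinct eigenvalues are numbered alike.\<close>

definition steklov_value :: "nat \<Rightarrow> real \<Rightarrow> real" where
  "steklov_value k \<rho> = (1 - \<rho>\<^sup>2) * (real k)\<^sup>2 / (4 * \<rho> ^ 3 * qser k (\<rho>\<^sup>2))"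

lemma steklov_value_strict_mono_index:
  assumes "0 < \<rho>" "\<rho> < 1"
  shows "strict_mono (\<lambda>k. steklov_value k \<rho>)"
proof (rule strict_monoI)
  fix k l :: nat assume kl: "k < l"
  have s: "0 < \<rho>\<^sup>2" "\<rho>\<^sup>2 < 1" using assms by (auto simp: abs_square_less_1)
  \<comment> \<open>Only a weak inequality, because both sides are 0 for \<open>k = 0\<close>;
    strictness comes from the squares in the next step.\<close>
  have "(real k)\<^sup>2 / qser k (\<rho>\<^sup>2) \<le> (real k)\<^sup>2 / qser l (\<rho>\<^sup>2)"
    using qser_pos[OF s] qser_antimono_index[OF s kl] by (intro divide_left_mono) (auto simp: less_imp_le)
  also have "\<dots> < (real l)\<^sup>2 / qser l (\<rho>\<^sup>2)"
    using qser_pos[OF s] kl by (intro divide_strict_right_mono) (auto simp: power_strict_mono)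
  finally have "(1 - \<rho>\<^sup>2) / (4 * \<rho> ^ 3) * ((real k)\<^sup>2 / qser k (\<rho>\<^sup>2))
      < (1 - \<rho>\<^sup>2) / (4 * \<rho> ^ 3) * ((real l)\<^sup>2 / qser l (\<rho>\<^sup>2))"
    using assms s by (intro mult_strict_left_mono) auto
  then show "steklov_value k \<rho> < steklov_value l \<rho>" by (simp add: steklov_value_def)
qed

text \<open>This is \<open>(1 - s)\<^sup>1\<^sup>/\<^sup>2 q\<^sub>k(s)\<close> squared, which
  avoids the root. Its derivative is positive by the first bound in
  \<open>qser'_bounds\<close>.\<close>

lemma one_minus_qser_strict_mono:
  assumes "0 < s" "s < t" "t < 1"
  shows "(1 - s) * (qser k s)\<^sup>2 < (1 - t) * (qser k t)\<^sup>2"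
proof (rule DERIV_pos_imp_increasing[OF assms(2)])
  fix x assume "s \<le> x" "x \<le> t"
  then have x: "0 < x" "x < 1" using assms by auto
  have "((\<lambda>s. (1 - s) * (qser k s)\<^sup>2) has_real_derivative
      2 * qser k x * ((1 - x) * qser' k x - qser k x / 2)) (at x)"
    using x by (auto intro!: derivative_eq_intros qser_has_derivative)
      (simp add: power2_eq_square algebra_simps)
  moreover have "2 * qser k x * ((1 - x) * qser' k x - qser k x / 2) > 0"
    using qser_pos[OF x] qser'_bounds[OF x] by (intro mult_pos_pos) auto
  ultimately show "\<exists>y. ((\<lambda>s. (1 - s) * (qser k s)\<^sup>2) has_real_derivative y) (at x) \<and> 0 < y" by blast
qed

lemma one_minus_sq_qser_strict_antimono:
  assumes "0 < s" "s < t" "t < 1"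
  shows "(1 - t)\<^sup>2 * qser k t < (1 - s)\<^sup>2 * qser k s"
proof (rule DERIV_neg_imp_decreasing[OF assms(2)])
  fix x assume "s \<le> x" "x \<le> t"
  then have x: "0 < x" "x < 1" using assms by auto
  have "((\<lambda>s. (1 - s)\<^sup>2 * qser k s) has_real_derivative
      (1 - x) * ((1 - x) * qser' k x - 2 * qser k x)) (at x)"
    using x by (auto intro!: derivative_eq_intros qser_has_derivative)
      (simp add: power2_eq_square algebra_simps)
  moreover have "(1 - x) * ((1 - x) * qser' k x - 2 * qser k x) < 0"
    using x qser'_bounds[OF x] by (intro mult_pos_neg) auto
  ultimately show "\<exists>y. ((\<lambda>s. (1 - s)\<^sup>2 * qser k s) has_real_derivative y) (at x) \<and> y < 0" by blast
qed

section \<open>The substitution of \<open>tanh (R / 2)\<close> for the Euclidean radius\<close>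

lemma tanh_half_facts:
  fixes R :: real
  assumes "R > 0"
  shows "0 < tanh (R / 2)" "tanh (R / 2) < 1" "0 < (tanh (R / 2))\<^sup>2" "(tanh (R / 2))\<^sup>2 < 1"
    "1 - (tanh (R / 2))\<^sup>2 = 1 / (cosh (R / 2))\<^sup>2"
proof -
  show t: "0 < tanh (R / 2)" "tanh (R / 2) < 1" using assms by (auto simp: tanh_real_lt_1)
  then show "0 < (tanh (R / 2))\<^sup>2" "(tanh (R / 2))\<^sup>2 < 1" by (auto simp: abs_square_less_1)
  have "1 - (tanh (R / 2))\<^sup>2 = ((cosh (R / 2))\<^sup>2 - (sinh (R / 2))\<^sup>2) / (cosh (R / 2))\<^sup>2"
    by (simp add: tanh_def power_divide diff_divide_distrib)
  then show "1 - (tanh (R / 2))\<^sup>2 = 1 / (cosh (R / 2))\<^sup>2" by (simp only: hyperbolic_pythagoras)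
qed

lemma tanh_half_sq_less:
  fixes R T :: real
  assumes "0 < R" "R < T"
  shows "(tanh (R / 2))\<^sup>2 < (tanh (T / 2))\<^sup>2"
  using assms tanh_half_facts(1)[of R] by (intro power_strict_mono) auto

text \<open>With \<open>\<rho> = sinh (R / 2) / cosh (R / 2)\<close>, the cube of
  \<open>sinh\<close> cancels, and \<open>1 - \<rho>\<^sup>2 = 1 / (cosh (R / 2))\<^sup>2\<close>
  reduces \<open>cosh\<close> to the first power.\<close>

lemma steklov_value_sinh_half:
  assumes "R > 0"
  shows "steklov_value k (tanh (R / 2)) * sinh (R / 2) ^ 3
       = (real k)\<^sup>2 / 4 * (cosh (R / 2) / qser k ((tanh (R / 2))\<^sup>2))"
proof -
  have "sinh (R / 2) > 0" "cosh (R / 2) > 0" "qser k ((tanh (R / 2))\<^sup>2) > 0"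
    using assms qser_pos tanh_half_facts[OF assms] by auto
  then show ?thesis unfolding steklov_value_def tanh_half_facts(5)[OF assms]
    by (simp add: tanh_def[of "R/2"] power_divide field_simps power2_eq_square power3_eq_cube)
qed

lemma steklov_value_sinh_half_strict_antimono:
  assumes "k \<ge> 1"
  shows "strict_antimono_on {0<..} (\<lambda>R. steklov_value k (tanh (R / 2)) * sinh (R / 2) ^ 3)"
proof (rule monotone_onI)
  fix R T :: real assume RT: "R \<in> {0<..}" "T \<in> {0<..}" "R < T"
  define s where "s = (tanh (R / 2))\<^sup>2"
  define t where "t = (tanh (T / 2))\<^sup>2"
  have st: "0 < s" "s < t" "t < 1" "0 < t" "s < 1"
    using RT tanh_half_facts[of R] tanh_half_facts[of T] tanh_half_sq_less[of R T]
    by (auto simp: s_def t_def)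
  \<comment> \<open>Squares are compared, since \<open>(cosh (r / 2))\<^sup>2 = 1 / (1 - s)\<close>
    turns the squared quotient into a function of \<open>s\<close> alone.\<close>
  have e: "(cosh (r / 2) / qser k ((tanh (r / 2))\<^sup>2))\<^sup>2
      = 1 / ((1 - (tanh (r / 2))\<^sup>2) * (qser k ((tanh (r / 2))\<^sup>2))\<^sup>2)" if "r > 0" for r
    unfolding tanh_half_facts(5)[OF that] by (simp add: power_divide)
  have "1 / ((1 - t) * (qser k t)\<^sup>2) < 1 / ((1 - s) * (qser k s)\<^sup>2)"
    using one_minus_qser_strict_mono[OF st(1-3), of k] qser_pos[of s k] st
    by (intro divide_strict_left_mono) (auto intro!: mult_pos_pos simp: qser_pos less_imp_neq[symmetric])
  then have "(cosh (T / 2) / qser k t)\<^sup>2 < (cosh (R / 2) / qser k s)\<^sup>2"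
    using e[of R] e[of T] RT by (simp add: s_def t_def)
  then have "cosh (T / 2) / qser k t < cosh (R / 2) / qser k s"
    using qser_pos[of s k] st by (elim power2_less_imp_less) auto
  then have "(real k)\<^sup>2 / 4 * (cosh (T / 2) / qser k t) < (real k)\<^sup>2 / 4 * (cosh (R / 2) / qser k s)"
    using assms by (intro mult_strict_left_mono) auto
  then show "steklov_value k (tanh (T / 2)) * sinh (T / 2) ^ 3
      < steklov_value k (tanh (R / 2)) * sinh (R / 2) ^ 3"
    using RT by (simp add: steklov_value_sinh_half s_def t_def)
qed

lemma steklov_value_sinh_strict_mono:
  assumes "k \<ge> 1"
  shows "strict_mono_on {0<..} (\<lambda>R. steklov_value k (tanh (R / 2)) * sinh R ^ 3)"
proof (rule strict_mono_onI)
  fix R T :: real assume RT: "R \<in> {0<..}" "T \<in> {0<..}" "R < T"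
  define s where "s = (tanh (R / 2))\<^sup>2"
  define t where "t = (tanh (T / 2))\<^sup>2"
  have st: "0 < s" "s < t" "t < 1" "0 < t" "s < 1"
    using RT tanh_half_facts[of R] tanh_half_facts[of T] tanh_half_sq_less[of R T]
    by (auto simp: s_def t_def)
  \<comment> \<open>The duplication formula contributes \<open>8 * cosh (r / 2) ^ 3\<close> to the
    previous normal form; the resulting fourth power of \<open>cosh\<close> is
    \<open>1 / (1 - s)\<^sup>2\<close>.\<close>
  have e: "steklov_value k (tanh (r / 2)) * sinh r ^ 3 =
      2 * (real k)\<^sup>2 / ((1 - (tanh (r / 2))\<^sup>2)\<^sup>2 * qser k ((tanh (r / 2))\<^sup>2))" if r: "r > 0" for r
  proof -
    have "sinh r = 2 * sinh (r / 2) * cosh (r / 2)" using sinh_double[of "r / 2"] by simp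
    then have "steklov_value k (tanh (r / 2)) * sinh r ^ 3
        = 8 * cosh (r / 2) ^ 3 * (steklov_value k (tanh (r / 2)) * sinh (r / 2) ^ 3)"
      by (simp add: power_mult_distrib)
    also have "\<dots> = 2 * (real k)\<^sup>2 * cosh (r / 2) ^ 4 / qser k ((tanh (r / 2))\<^sup>2)"
      unfolding steklov_value_sinh_half[OF r] by (simp add: eval_nat_numeral)
    also have "\<dots> = 2 * (real k)\<^sup>2 / ((1 / (cosh (r / 2))\<^sup>2)\<^sup>2 * qser k ((tanh (r / 2))\<^sup>2))"
      by (simp add: power_divide flip: power_mult)
    finally show ?thesis unfolding tanh_half_facts(5)[OF r] .
  qed
  have "2 * (real k)\<^sup>2 / ((1 - s)\<^sup>2 * qser k s) < 2 * (real k)\<^sup>2 / ((1 - t)\<^sup>2 * qser k t)"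
    using one_minus_sq_qser_strict_antimono[OF st(1-3), of k] qser_pos[of t k] qser_pos[of s k] st assms
    by (intro divide_strict_left_mono) auto
  then show "steklov_value k (tanh (R / 2)) * sinh R ^ 3 < steklov_value k (tanh (T / 2)) * sinh T ^ 3"
    using e[of R] e[of T] RT by (simp add: s_def t_def)
qed

text \<open>Serves to change the weight: \<open>f\<close> carries the cube of
  \<open>sinh (R / 2)\<close>, and \<open>g\<close> is the quotient of the new weight by
  \<open>sinh (R / 2)\<close>.\<close>

lemma strict_antimono_on_mult:
  fixes f g h :: "real \<Rightarrow> real"
  assumes "strict_antimono_on S f" "strict_antimono_on S g"
    "\<And>x. x \<in> S \<Longrightarrow> 0 < f x" "\<And>x. x \<in> S \<Longrightarrow> 0 < g x" "\<And>x. x \<in> S \<Longrightarrow> h x = f x * g x ^ 3"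
  shows "strict_antimono_on S h"
proof (rule monotone_onI)
  fix x y assume xy: "x \<in> S" "y \<in> S" "x < y"
  have "f y < f x" "g y < g x" using assms(1,2) xy by (auto simp: monotone_on_def)
  then have "f y * g y ^ 3 < f x * g x ^ 3"
    using assms(3,4) xy by (intro mult_strict_mono power_strict_mono) (auto simp: less_imp_le)
  then show "h y < h x" using assms(5) xy by simp
qed

lemma inverse_cosh_half_strict_antimono: "strict_antimono_on {0<..} (\<lambda>R::real. 1 / cosh (R / 2))"
  by (rule monotone_onI)
     (auto intro!: divide_strict_left_mono cosh_real_strict_mono[unfolded monotone_on_def, rule_format])

lemma div_sinh_half_strict_antimono: "strict_antimono_on {0<..} (\<lambda>R::real. R / sinh (R / 2))"
proof (rule monotone_onI)
  fix R T :: real assume RT: "R \<in> {0<..}" "T \<in> {0<..}" "R < T"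
  \<comment> \<open>Equivalent to \<open>tanh x < x\<close>. At half the argument it makes the
    numerator of the derivative of \<open>x / sinh (x / 2)\<close> negative.\<close>
  have sl: "x * cosh x > sinh x" if "x > 0" for x :: real
  proof -
    have "(\<lambda>x. x * cosh x - sinh x) 0 < (\<lambda>x::real. x * cosh x - sinh x) x"
    proof (rule DERIV_pos_imp_increasing_open[OF that])
      fix y :: real assume "0 < y" "y < x"
      moreover have "((\<lambda>x. x * cosh x - sinh x) has_real_derivative y * sinh y) (at y)"
        by (auto intro!: derivative_eq_intros)
      ultimately show "\<exists>z. ((\<lambda>x. x * cosh x - sinh x) has_real_derivative z) (at y) \<and> 0 < z"
        by (meson mult_pos_pos sinh_real_pos_iff)
    qed (intro continuous_intros)
    then show ?thesis by simp
  qed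
  show "T / sinh (T / 2) < R / sinh (R / 2)"
  proof (rule DERIV_neg_imp_decreasing[OF RT(3)])
    fix x assume "R \<le> x" "x \<le> T"
    then have x: "x > 0" using RT by auto
    have "((\<lambda>x. x / sinh (x / 2)) has_real_derivative
        (sinh (x / 2) - x / 2 * cosh (x / 2)) / (sinh (x / 2))\<^sup>2) (at x)"
      using x by (auto intro!: derivative_eq_intros simp: power2_eq_square)
    moreover have "(sinh (x / 2) - x / 2 * cosh (x / 2)) / (sinh (x / 2))\<^sup>2 < 0"
      using sl[of "x / 2"] x by (intro divide_neg_pos) auto
    ultimately show "\<exists>y. ((\<lambda>x. x / sinh (x / 2)) has_real_derivative y) (at x) \<and> y < 0" by blast
  qed
qed

lemma steklov_value_monotonicity:
  assumes "m \<ge> 1"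
    and "\<And>R. R > 0 \<Longrightarrow> f R = steklov_value m (tanh (R / 2))"
  shows "strict_antimono_on {0<..} (\<lambda>R. f R * R ^ 3) \<and>
         strict_mono_on {0<..} (\<lambda>R. f R * sinh R ^ 3) \<and>
         strict_antimono_on {0<..} (\<lambda>R. f R * tanh (R / 2) ^ 3) \<and>
         strict_antimono_on {0<..} (\<lambda>R. f R * sinh (R / 2) ^ 3)"
proof -
  have A: "strict_antimono_on {0<..} (\<lambda>R. f R * sinh (R / 2) ^ 3)"
    using steklov_value_sinh_half_strict_antimono[OF assms(1)]
    by (simp add: monotone_on_def assms(2))
  have B: "strict_mono_on {0<..} (\<lambda>R. f R * sinh R ^ 3)"
    using steklov_value_sinh_strict_mono[OF assms(1)] by (simp add: monotone_on_def assms(2))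
  have p: "0 < f R * sinh (R / 2) ^ 3" if "R \<in> {0<..}" for R
    using that assms steklov_value_sinh_half[of R m] qser_pos tanh_half_facts[of R] by simp
  have "strict_antimono_on {0<..} (\<lambda>R. f R * R ^ 3)"
    by (rule strict_antimono_on_mult[OF A div_sinh_half_strict_antimono p])
       (auto simp: power_divide)
  moreover have "strict_antimono_on {0<..} (\<lambda>R. f R * tanh (R / 2) ^ 3)"
    by (rule strict_antimono_on_mult[OF A inverse_cosh_half_strict_antimono p])
       (auto simp: power_divide tanh_def)
  ultimately show ?thesis using A B by simp
qed

section \<open>Angular Fourier coefficients\<close>

text \<open>Euclidean polar coordinates: \<open>r\<close> is the radius in the chart, unlike the
  geodesic radius in \<open>hyp_polar\<close>. Negative \<open>r\<close> is meaningful, so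
  derivatives in \<open>r\<close> at 0 are two-sided.\<close>

definition polar :: "real \<Rightarrow> real \<Rightarrow> real^2" where
  "polar r t = vector [r * cos t, r * sin t]"

lemma polar_nth [simp]: "polar r t $ 1 = r * cos t" "polar r t $ 2 = r * sin t"
  by (simp_all add: polar_def)

lemma polar_eq: "polar r t = (r * cos t) *\<^sub>R axis 1 1 + (r * sin t) *\<^sub>R axis 2 1"
  by (simp add: vec_eq_iff forall_2 axis_def)

lemma inner_polar [simp]: "polar r t \<bullet> polar r t = r\<^sup>2"
proof -
  have "polar r t \<bullet> polar r t = r\<^sup>2 * ((cos t)\<^sup>2 + (sin t)\<^sup>2)"
    by (simp add: inner_vec_def UNIV_2 power2_eq_square algebra_simps
        del: sin_cos_squared_add sin_cos_squared_add2 sin_cos_squared_add3)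
  then show ?thesis by simp
qed

lemma norm_polar [simp]: "norm (polar r t) = \<bar>r\<bar>"
  by (simp add: norm_eq_sqrt_inner)

lemma polar_surj:
  obtains t where "0 \<le> t" "t \<le> 2 * pi" "x = polar (norm x) t"
proof (cases "x = 0")
  case True
  then show ?thesis using that[of 0] by (simp add: vec_eq_iff forall_2)
next
  case False
  have "(x $ 1)\<^sup>2 + (x $ 2)\<^sup>2 = (norm x)\<^sup>2"
    unfolding power2_norm_eq_inner by (simp add: inner_vec_def UNIV_2 power2_eq_square)
  then have "(x $ 1 / norm x)\<^sup>2 + (x $ 2 / norm x)\<^sup>2 = 1"
    using False by (simp add: power_divide flip: add_divide_distrib)
  from sincos_total_2pi[OF this] obtain t where t: "0 \<le> t" "t < 2 * pi"
    "cos t = x $ 1 / norm x" "sin t = x $ 2 / norm x" by metis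
  then have "x = polar (norm x) t"
    using False by (simp add: vec_eq_iff forall_2)
  then show ?thesis using that[of t] t(1,2) by simp
qed

lemma continuous_on_polar [continuous_intros]:
  fixes f g :: "'a::t2_space \<Rightarrow> real"
  shows "continuous_on S f \<Longrightarrow> continuous_on S g \<Longrightarrow> continuous_on S (\<lambda>x. polar (f x) (g x))"
  unfolding polar_eq by (intro continuous_intros)

lemma DERIV_polar_radius:
  assumes "f differentiable (at (polar r t))"
  shows "((\<lambda>r. f (polar r t)) has_real_derivative
    cos t * pderiv_at 1 f (polar r t) + sin t * pderiv_at 2 f (polar r t)) (at r)"
proof -
  have "((\<lambda>r. polar r t) has_derivative (\<lambda>h. h *\<^sub>R polar 1 t)) (at r)"
    unfolding polar_eq by (auto intro!: derivative_eq_intros simp: algebra_simps)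
  note D = has_derivative_compose[OF this has_derivative_pderiv_at[OF assms]]
  show ?thesis unfolding has_field_derivative_def
    by (rule has_derivative_eq_rhs[OF D]) (simp add: fun_eq_iff sum_2 algebra_simps)
qed

lemma DERIV_polar_angle:
  assumes "f differentiable (at (polar r t))"
  shows "((\<lambda>t. f (polar r t)) has_real_derivative
    - (r * sin t) * pderiv_at 1 f (polar r t) + r * cos t * pderiv_at 2 f (polar r t)) (at t)"
proof -
  have "((\<lambda>t. polar r t) has_derivative
      (\<lambda>h. h *\<^sub>R ((- (r * sin t)) *\<^sub>R axis 1 1 + (r * cos t) *\<^sub>R axis 2 1))) (at t)"
    unfolding polar_eq by (auto intro!: derivative_eq_intros simp: algebra_simps)
  note D = has_derivative_compose[OF this has_derivative_pderiv_at[OF assms]]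
  show ?thesis unfolding has_field_derivative_def
    by (rule has_derivative_eq_rhs[OF D]) (simp add: fun_eq_iff sum_2 axis_def algebra_simps)
qed

text \<open>The unnormalised Fourier coefficient on the circle of radius \<open>r\<close>. The
  weight is left arbitrary because a derivative in \<open>r\<close> multiplies it by
  \<open>cos t\<close> or \<open>sin t\<close>.\<close>

definition fcoef :: "(real \<Rightarrow> real) \<Rightarrow> (real^2 \<Rightarrow> real) \<Rightarrow> real \<Rightarrow> real" where
  "fcoef w f r = integral {0..2 * pi} (\<lambda>t. w t * f (polar r t))"

lemma continuous_on_polar_comp:
  assumes "continuous_on (ball 0 \<rho>) f" "\<bar>r\<bar> < \<rho>"
  shows "continuous_on S (\<lambda>t. f (polar r t))"
proof (rule continuous_on_compose2[OF assms(1)])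
  show "continuous_on S (\<lambda>t. polar r t)" by (intro continuous_intros)
qed (use assms(2) in auto)

lemma fcoef_has_integral:
  assumes "continuous_on UNIV w" "continuous_on (ball 0 \<rho>) f" "\<bar>r\<bar> < \<rho>"
  shows "((\<lambda>t. w t * f (polar r t)) has_integral fcoef w f r) {0..2 * pi}"
  unfolding fcoef_def
  by (intro integrable_integral integrable_continuous_real continuous_on_mult
      continuous_on_polar_comp[OF assms(2,3)] continuous_on_subset[OF assms(1)]) simp

text \<open>The radial derivative of \<open>fcoef w f\<close>, expressed through
  \<open>fcoef\<close> again, so that one differentiation lemma also yields the second derivative
  \<open>fcoef2\<close>.\<close>

definition fcoef1 :: "(real \<Rightarrow> real) \<Rightarrow> (real^2 \<Rightarrow> real) \<Rightarrow> real \<Rightarrow> real" where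
  "fcoef1 w f r = fcoef (\<lambda>t. w t * cos t) (pderiv_at 1 f) r + fcoef (\<lambda>t. w t * sin t) (pderiv_at 2 f) r"

definition fcoef2 :: "(real \<Rightarrow> real) \<Rightarrow> (real^2 \<Rightarrow> real) \<Rightarrow> real \<Rightarrow> real" where
  "fcoef2 w f r = fcoef1 (\<lambda>t. w t * cos t) (pderiv_at 1 f) r + fcoef1 (\<lambda>t. w t * sin t) (pderiv_at 2 f) r"

text \<open>Differentiation under the integral sign, over an open interval of radii that contains 0
  in its interior.\<close>

lemma fcoef_has_derivative:
  assumes w: "continuous_on UNIV w" and f: "Ck_on 1 (ball 0 \<rho>) f" and r: "\<bar>r\<bar> < \<rho>"
  shows "(fcoef w f has_real_derivative fcoef1 w f r) (at r)"
proof -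
  define U where "U = {-\<rho><..<\<rho>}"
  define fx where "fx x t = w t * cos t * pderiv_at 1 f (polar x t)
      + w t * sin t * pderiv_at 2 f (polar x t)" for x t
  have d: "f differentiable (at x)" if "norm x < \<rho>" for x using f that by simp
  have cf: "continuous_on (ball 0 \<rho>) f"
    using Ck_on_SucD[of 0] f by simp
  have cp: "continuous_on (ball 0 \<rho>) (pderiv_at i f)" for i using f by simp
  have wc: "continuous_on S w" for S using w continuous_on_subset by blast
  have wc2: "continuous_on S (\<lambda>p. w (snd p))" for S :: "(real \<times> real) set"
    by (rule continuous_on_compose2[OF w]) (auto intro!: continuous_intros)
  have "((\<lambda>x. integral (cbox 0 (2 * pi)) (\<lambda>t. w t * f (polar x t))) has_real_derivative
      integral (cbox 0 (2 * pi)) (fx r)) (at r within U)"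
  proof (rule leibniz_rule_field_derivative)
    show "((\<lambda>x. w t * f (polar x t)) has_real_derivative fx x t) (at x within U)"
      if "x \<in> U" "t \<in> cbox 0 (2 * pi)" for x t
      unfolding fx_def
      by (rule has_field_derivative_at_within,
          rule DERIV_cong[OF DERIV_cmult[OF DERIV_polar_radius[OF d]]])
         (use that in \<open>auto simp: U_def algebra_simps abs_less_iff\<close>)
    show "(\<lambda>t. w t * f (polar x t)) integrable_on cbox 0 (2 * pi)" if "x \<in> U" for x
      using fcoef_has_integral[OF w cf, of x] that by (auto simp: U_def abs_less_iff)
    have "continuous_on (U \<times> cbox 0 (2 * pi)) (\<lambda>p. pderiv_at i f (polar (fst p) (snd p)))" for i
      by (rule continuous_on_compose2[OF cp]) (auto intro!: continuous_intros simp: U_def abs_less_iff)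
    then show "continuous_on (U \<times> cbox 0 (2 * pi)) (\<lambda>(x, t). fx x t)"
      unfolding fx_def split_def by (intro continuous_intros wc2) auto
    show "r \<in> U" "convex U" using r by (auto simp: U_def)
  qed
  moreover have "integral (cbox 0 (2 * pi)) (fx r) = fcoef1 w f r"
    unfolding fx_def fcoef1_def cbox_interval
    by (intro integral_unique has_integral_add fcoef_has_integral[OF _ cp r] continuous_intros wc)
  moreover have "(at r within U) = at r"
    by (rule at_within_open) (use r in \<open>auto simp: U_def\<close>)
  ultimately show ?thesis by (simp add: fcoef_def[abs_def])
qed

lemma fcoef1_has_derivative:
  assumes w: "continuous_on UNIV w" and f: "Ck_on 2 (ball 0 \<rho>) f" and r: "\<bar>r\<bar> < \<rho>"
  shows "(fcoef1 w f has_real_derivative fcoef2 w f r) (at r)"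
proof -
  have "Ck_on 1 (ball 0 \<rho>) (pderiv_at i f)" for i using f by (simp add: numeral_2_eq_2)
  then show ?thesis
    unfolding fcoef1_def[of w f, abs_def] fcoef2_def
    by (intro DERIV_add fcoef_has_derivative[OF _ _ r] continuous_intros w)
qed

definition eucl_laplacian :: "(real^'n \<Rightarrow> real) \<Rightarrow> real^'n \<Rightarrow> real" where
  "eucl_laplacian f x = (\<Sum>i\<in>UNIV. pderiv_at i (pderiv_at i f) x)"

text \<open>Two integrations by parts move the angular part \<open>\<partial>\<^sub>\<theta>\<^sup>2\<close> of the Laplacian onto the
  weight \<open>w\<close>. Only the sum of the two mixed partial derivatives occurs, so their equality is not
  needed.\<close>

lemma fcoef_ode:
  assumes w: "\<And>t. (w has_real_derivative w1 t) (at t)" "\<And>t. (w1 has_real_derivative - (\<kappa>\<^sup>2 * w t)) (at t)"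
    and per: "w (2 * pi) = w 0" "w1 (2 * pi) = w1 0"
    and f: "Ck_on 2 (ball 0 \<rho>) f" and r: "\<bar>r\<bar> < \<rho>"
  shows "r\<^sup>2 * fcoef2 w f r + r * fcoef1 w f r - \<kappa>\<^sup>2 * fcoef w f r = r\<^sup>2 * fcoef w (eucl_laplacian f) r"
proof -
  have wc: "continuous_on S w" for S
    using w(1) by (meson DERIV_atLeastAtMost_imp_continuous_on DERIV_isCont continuous_at_imp_continuous_on)
  define F where "F t = f (polar r t)" for t
  define F1 where "F1 t = pderiv_at 1 f (polar r t)" for t
  define F2 where "F2 t = pderiv_at 2 f (polar r t)" for t
  define F11 where "F11 t = pderiv_at 1 (pderiv_at 1 f) (polar r t)" for t
  define F12 where "F12 t = pderiv_at 2 (pderiv_at 1 f) (polar r t)" for t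
  define F21 where "F21 t = pderiv_at 1 (pderiv_at 2 f) (polar r t)" for t
  define F22 where "F22 t = pderiv_at 2 (pderiv_at 2 f) (polar r t)" for t
  note Fs = F_def F1_def F2_def F11_def F12_def F21_def F22_def
  have d: "f differentiable (at (polar r t))" "pderiv_at i f differentiable (at (polar r t))" for t i
    using f r by (simp_all add: numeral_2_eq_2)
  have c2: "continuous_on (ball 0 \<rho>) (pderiv_at i (pderiv_at j f))" for i j
    using f by (simp add: numeral_2_eq_2)
  have c01: "continuous_on (ball 0 \<rho>) f" "continuous_on (ball 0 \<rho>) (pderiv_at i f)" for i
    using f Ck_on_SucD[OF Ck_on_SucD, of 0 "ball 0 \<rho>" f] Ck_on_SucD[of 0 "ball 0 \<rho>" "pderiv_at i f"]
    by (simp_all add: numeral_2_eq_2)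
  have cl: "continuous_on (ball 0 \<rho>) (eucl_laplacian f)"
    unfolding eucl_laplacian_def[abs_def] by (intro continuous_intros c2)
  have dF: "(F has_real_derivative - (r * sin t) * F1 t + r * cos t * F2 t) (at t)"
    "(F1 has_real_derivative - (r * sin t) * F11 t + r * cos t * F12 t) (at t)"
    "(F2 has_real_derivative - (r * sin t) * F21 t + r * cos t * F22 t) (at t)" for t
    unfolding Fs by (rule DERIV_polar_angle d)+
  \<comment> \<open>The boundary term of both integrations by parts. Its derivative is
    \<open>- w\<close> times the second angular derivative of \<open>F\<close> minus
    \<open>\<kappa>\<^sup>2 * w * F\<close>, which the polar form of the Laplacian turns into
    \<open>h\<close>; by periodicity its total increment is 0.\<close>
  define Q where "Q t = F t * w1 t - (- (r * sin t) * F1 t + r * cos t * F2 t) * w t" for t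
  define h where "h t = r\<^sup>2 * ((w t * cos t * cos t * F11 t + w t * cos t * sin t * F12 t)
      + (w t * sin t * cos t * F21 t + w t * sin t * sin t * F22 t))
      + r * (w t * cos t * F1 t + w t * sin t * F2 t) - \<kappa>\<^sup>2 * (w t * F t)
      - r\<^sup>2 * (w t * (F11 t + F22 t))" for t
  have sc: "(sin t)\<^sup>2 = 1 - (cos t)\<^sup>2" for t :: real by (simp add: sin_squared_eq)
  have dQ: "(Q has_real_derivative h t) (at t)" for t
  proof -
    have "(Q has_real_derivative
      (- (r * sin t) * F1 t + r * cos t * F2 t) * w1 t + F t * (- (\<kappa>\<^sup>2 * w t))
      - ((- (r * cos t) * F1 t - r * sin t * (- (r * sin t) * F11 t + r * cos t * F12 t)
          - r * sin t * F2 t + r * cos t * (- (r * sin t) * F21 t + r * cos t * F22 t)) * w t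
         + (- (r * sin t) * F1 t + r * cos t * F2 t) * w1 t)) (at t)"
      unfolding Q_def
      by (auto intro!: derivative_eq_intros dF w)
    moreover have "(- (r * sin t) * F1 t + r * cos t * F2 t) * w1 t + F t * (- (\<kappa>\<^sup>2 * w t))
      - ((- (r * cos t) * F1 t - r * sin t * (- (r * sin t) * F11 t + r * cos t * F12 t)
          - r * sin t * F2 t + r * cos t * (- (r * sin t) * F21 t + r * cos t * F22 t)) * w t
         + (- (r * sin t) * F1 t + r * cos t * F2 t) * w1 t) = h t"
      using sc[of t] unfolding h_def by algebra
    ultimately show ?thesis by simp
  qed
  have "(h has_integral Q (2 * pi) - Q 0) {0..2 * pi}"
    by (intro fundamental_theorem_of_calculus
        has_field_derivative_at_within[OF dQ, unfolded has_real_derivative_iff_has_vector_derivative]) simp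
  moreover have "Q (2 * pi) - Q 0 = 0"
    by (simp add: Q_def Fs per polar_def)
  moreover have "(h has_integral (r\<^sup>2 * fcoef2 w f r + r * fcoef1 w f r - \<kappa>\<^sup>2 * fcoef w f r
      - r\<^sup>2 * fcoef w (eucl_laplacian f) r)) {0..2 * pi}"
  proof -
    have l: "eucl_laplacian f (polar r t) = F11 t + F22 t" for t
      by (simp add: eucl_laplacian_def Fs sum_2)
    show ?thesis
      unfolding h_def fcoef2_def fcoef1_def Fs
      by (intro has_integral_add has_integral_diff has_integral_mult_right
          fcoef_has_integral[OF _ _ r] c01 c2 continuous_intros wc
          fcoef_has_integral[OF _ cl r, unfolded l Fs])
  qed
  ultimately have "r\<^sup>2 * fcoef2 w f r + r * fcoef1 w f r - \<kappa>\<^sup>2 * fcoef w f r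
      - r\<^sup>2 * fcoef w (eucl_laplacian f) r = 0"
    using has_integral_unique by metis
  then show ?thesis by simp
qed

section \<open>Trigonometric polynomials and uniqueness of Fourier coefficients\<close>

inductive trig_poly :: "(real \<Rightarrow> real) \<Rightarrow> bool" where
  cos: "trig_poly (\<lambda>t. cos (real k * t))"
| sin: "trig_poly (\<lambda>t. sin (real k * t))"
| add: "trig_poly f \<Longrightarrow> trig_poly g \<Longrightarrow> trig_poly (\<lambda>t. f t + g t)"
| cmult: "trig_poly f \<Longrightarrow> trig_poly (\<lambda>t. c * f t)"

lemma trig_poly_const: "trig_poly (\<lambda>_. c)"
  using trig_poly.cmult[OF trig_poly.cos[of 0], of c] by simp

text \<open>The product-to-sum formulas. They involve the frequency \<open>k - 1\<close>, hence the
  separate case \<open>k = 0\<close>.\<close>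

lemma trig_poly_mult_cos_sin:
  assumes "trig_poly w"
  shows "trig_poly (\<lambda>t. cos t * w t) \<and> trig_poly (\<lambda>t. sin t * w t)"
  using assms
proof induction
  case (cos k)
  show ?case
  proof (cases k)
    case 0
    then show ?thesis using trig_poly.cos[of 1] trig_poly.sin[of 1] by simp
  next
    case (Suc n)
    have n: "real n * t = real k * t - t" "real (Suc k) * t = real k * t + t" for t
      by (simp_all add: Suc algebra_simps)
    have "cos t * cos (real k * t) = 1/2 * (cos (real n * t) + cos (real (Suc k) * t))" for t
      unfolding n by (simp add: cos_add cos_diff field_simps)
    moreover have "sin t * cos (real k * t) = 1/2 * (sin (real (Suc k) * t) + (-1) * sin (real n * t))" for t
      unfolding n by (simp add: cos_add cos_diff sin_add sin_diff field_simps)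
    ultimately show ?thesis by (simp only:) (intro conjI trig_poly.intros)
  qed
next
  case (sin k)
  show ?case
  proof (cases k)
    case 0
    then show ?thesis using trig_poly_const[of 0] by simp
  next
    case (Suc n)
    have n: "real n * t = real k * t - t" "real (Suc k) * t = real k * t + t" for t
      by (simp_all add: Suc algebra_simps)
    have "cos t * sin (real k * t) = 1/2 * (sin (real n * t) + sin (real (Suc k) * t))" for t
      unfolding n by (simp add: cos_add cos_diff sin_add sin_diff field_simps)
    moreover have "sin t * sin (real k * t) = 1/2 * (cos (real n * t) + (-1) * cos (real (Suc k) * t))" for t
      unfolding n by (simp add: cos_add cos_diff sin_add sin_diff field_simps)
    ultimately show ?thesis by (simp only:) (intro conjI trig_poly.intros)
  qed
next
  case (add f g)
  then show ?case by (auto simp: distrib_left intro!: trig_poly.intros)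
next
  case (cmult f c)
  then show ?case by (auto simp: mult.left_commute[of _ c] intro!: trig_poly.intros)
qed

text \<open>With an arbitrary factor \<open>w\<close>, the case of a product \<open>f * g\<close> is
  the induction hypothesis applied twice; linear functions reduce to multiplication by
  \<open>cos\<close> and \<open>sin\<close>.\<close>

lemma trig_poly_polynomial_mult:
  assumes "real_polynomial_function p" "trig_poly w"
  shows "trig_poly (\<lambda>t. p (polar r t) * w t)"
  using assms
proof (induction arbitrary: w)
  case (linear p)
  interpret bounded_linear p by fact
  have "p (polar r t) * w t
      = r * p (axis 1 1) * (cos t * w t) + r * p (axis 2 1) * (sin t * w t)" for t
    unfolding polar_eq by (simp add: add scale algebra_simps)
  then show ?case
    using trig_poly_mult_cos_sin[OF linear.prems] by (auto intro!: trig_poly.intros)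
next
  case (const c)
  then show ?case by (intro trig_poly.intros)
next
  case (add f g)
  then show ?case by (auto simp: distrib_right intro!: trig_poly.intros)
next
  case (mult f g)
  then show ?case by (simp add: mult.assoc)
qed

text \<open>By Stone-Weierstrass a polynomial \<open>p\<close> is uniformly close to
  \<open>f\<close> on the circle. Restricted to the circle it is a trigonometric polynomial, hence
  orthogonal to \<open>f\<close>, so the integral of \<open>f\<^sup>2\<close> equals that of
  \<open>(f - p) * f\<close> and is arbitrarily small.\<close>

lemma fourier_uniqueness:
  assumes f: "continuous_on (sphere 0 r) f" and r: "r \<ge> 0"
    and "\<And>k. fcoef (\<lambda>t. cos (real k * t)) f r = 0"
    and "\<And>k. fcoef (\<lambda>t. sin (real k * t)) f r = 0"
    and x: "norm x = r"
  shows "f x = 0"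
proof -
  define F where "F t = f (polar r t)" for t
  have cF: "continuous_on S F" for S
    unfolding F_def by (rule continuous_on_compose2[OF f]) (use r in \<open>auto intro!: continuous_intros\<close>)
  have trig: "((\<lambda>t. w t * F t) has_integral 0) {0..2 * pi}" if "trig_poly w" for w
    using that
  proof induction
    case (cos k)
    have "(\<lambda>t. cos (real k * t) * F t) integrable_on {0..2 * pi}"
      by (intro integrable_continuous_real continuous_intros cF)
    from integrable_integral[OF this] assms(3)[of k] show ?case by (simp add: fcoef_def F_def)
  next
    case (sin k)
    have "(\<lambda>t. sin (real k * t) * F t) integrable_on {0..2 * pi}"
      by (intro integrable_continuous_real continuous_intros cF)
    from integrable_integral[OF this] assms(4)[of k] show ?case by (simp add: fcoef_def F_def)
  next
    case (add f g)
    then show ?case using has_integral_add[OF add.IH] by (simp add: distrib_right)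
  next
    case (cmult f c)
    then show ?case using has_integral_mult_right[of _ 0 _ c] by (simp add: mult.assoc)
  qed
  define B where "B = integral {0..2 * pi} (\<lambda>t. \<bar>F t\<bar>)"
  define I where "I = integral {0..2 * pi} (\<lambda>t. F t * F t)"
  have B0: "B \<ge> 0" unfolding B_def by (intro integral_nonneg integrable_continuous_real continuous_intros cF) auto
  have "I \<le> e * B" if e: "e > 0" for e
  proof -
    obtain p where p: "real_polynomial_function p" "\<And>x. x \<in> sphere 0 r \<Longrightarrow> \<bar>f x - p x\<bar> < e"
      using Stone_Weierstrass_real_polynomial_function[OF compact_sphere f e] by blast
    have tp: "trig_poly (\<lambda>t. p (polar r t))"
      using trig_poly_polynomial_mult[OF p(1) trig_poly_const[of 1]] by simp
    have i1: "((\<lambda>t. F t * F t - p (polar r t) * F t) has_integral I - 0) {0..2 * pi}"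
      unfolding I_def
      by (intro has_integral_diff trig[OF tp] integrable_integral integrable_continuous_real continuous_intros cF)
    have i2: "((\<lambda>t. e * \<bar>F t\<bar>) has_integral e * B) {0..2 * pi}"
      unfolding B_def
      by (intro has_integral_mult_right integrable_integral integrable_continuous_real continuous_intros cF)
    have "F t * F t - p (polar r t) * F t \<le> e * \<bar>F t\<bar>" for t
    proof -
      have "F t * F t - p (polar r t) * F t = (F t - p (polar r t)) * F t" by (simp add: algebra_simps)
      also have "\<dots> \<le> \<bar>F t - p (polar r t)\<bar> * \<bar>F t\<bar>" by (metis abs_ge_self abs_mult)
      also have "\<dots> \<le> e * \<bar>F t\<bar>"
        using p(2)[of "polar r t"] r by (intro mult_right_mono) (auto simp: F_def less_imp_le)
      finally show ?thesis .
    qed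
    then show ?thesis using has_integral_le[OF i1 i2] by simp
  qed
  note I_le = this
  have "I \<le> 0"
  proof (rule ccontr)
    assume "\<not> I \<le> 0"
    \<comment> \<open>This choice of \<open>e\<close> gives
      \<open>I \<le> I * B / (B + 1) < I\<close>; the added 1 avoids division by zero when
      \<open>B = 0\<close>.\<close>
    then show False using I_le[of "I / (B + 1)"] B0 by (simp add: field_simps)
  qed
  moreover have "I \<ge> 0" unfolding I_def
    by (intro integral_nonneg integrable_continuous_real continuous_intros cF) auto
  ultimately have "I = 0" by simp
  moreover have "continuous_on {0..2 * pi} (\<lambda>t. F t * F t)"
    by (intro continuous_intros cF)
  ultimately have "F t = 0" if "t \<in> {0..2 * pi}" for t
    using integral_eq_0_iff[of 0 "2 * pi" "\<lambda>t. F t * F t"] that pi_gt_zero by (auto simp: I_def)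
  then show ?thesis using polar_surj[of x] x by (metis F_def atLeastAtMost_iff)
qed

section \<open>The radial equation\<close>

text \<open>For \<open>r > 0\<close>, multiplying the equation by \<open>r\<close> to the power
  \<open>k - 1\<close> makes its left side the derivative of
  \<open>r ^ Suc k * A1 r - real k * r ^ k * A r\<close>. This expression and \<open>E\<close> both
  vanish at 0, where regularity of \<open>A\<close> enters.\<close>

lemma radial_ode_first_integral:
  assumes A: "\<And>r. 0 \<le> r \<Longrightarrow> r \<le> \<rho> \<Longrightarrow> (A has_real_derivative A1 r) (at r)"
    and A1: "\<And>r. 0 \<le> r \<Longrightarrow> r \<le> \<rho> \<Longrightarrow> (A1 has_real_derivative A2 r) (at r)"
    and ode: "\<And>r. 0 \<le> r \<Longrightarrow> r \<le> \<rho> \<Longrightarrow> r\<^sup>2 * A2 r + r * A1 r - (real k)\<^sup>2 * A r = r\<^sup>2 * g r"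
    and E: "\<And>r. 0 \<le> r \<Longrightarrow> r \<le> \<rho> \<Longrightarrow> (E has_real_derivative r ^ Suc k * g r) (at r)" "E 0 = 0"
    and r: "0 \<le> r" "r \<le> \<rho>"
  shows "r ^ Suc k * A1 r - real k * r ^ k * A r = E r"
proof (cases "r = 0")
  case True
  then show ?thesis using E(2) by (cases k) simp_all
next
  case False
  define Z where "Z r = r ^ Suc k * A1 r - real k * r ^ k * A r - E r" for r
  have dZ: "(Z has_real_derivative real (Suc k) * x ^ k * A1 x + x ^ Suc k * A2 x
      - (real k * (real k * x ^ (k - 1)) * A x + real k * x ^ k * A1 x) - x ^ Suc k * g x) (at x)"
    if "0 \<le> x" "x \<le> \<rho>" for x
    unfolding Z_def
    by (rule derivative_eq_intros A[OF that] A1[OF that] E(1)[OF that] refl)+ (simp add: algebra_simps)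
  \<comment> \<open>Here \<open>p\<close> and \<open>q\<close> stand for \<open>x ^ k\<close> and
    \<open>x ^ (k - 1)\<close>. The relation between them carries the factor
    \<open>K\<^sup>2\<close>, so it survives the truncated subtraction at
    \<open>k = 0\<close>.\<close>
  have aux: "((K + 1) * p * a1 + x * p * a2 - (K * (K * q) * a + K * p * a1) - x * p * b) * x
      = p * (x\<^sup>2 * a2 + x * a1 - K\<^sup>2 * a - x\<^sup>2 * b)"
    if "K * (K * q) * x = K\<^sup>2 * p" for K p q x a a1 a2 b :: real
    using that by algebra
  have "(Z has_real_derivative 0) (at x)" if x: "0 < x" "x < r" for x
  proof -
    have "real k * (real k * x ^ (k - 1)) * x = (real k)\<^sup>2 * x ^ k"
      by (cases k) (simp_all add: power2_eq_square)
    then have "(real (Suc k) * x ^ k * A1 x + x ^ Suc k * A2 x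
      - (real k * (real k * x ^ (k - 1)) * A x + real k * x ^ k * A1 x) - x ^ Suc k * g x) * x
      = x ^ k * (x\<^sup>2 * A2 x + x * A1 x - (real k)\<^sup>2 * A x - x\<^sup>2 * g x)"
      using aux[of "real k"] by (simp add: add.commute)
    also have "\<dots> = 0" using ode[of x] x r by simp
    finally show ?thesis using dZ[of x] x r by simp
  qed
  moreover have "continuous_on {0..r} Z"
    by (intro continuous_at_imp_continuous_on ballI DERIV_isCont[OF dZ]) (use r in auto)
  ultimately have "Z r = Z 0" using DERIV_isconst2[of 0 r Z r] False r by auto
  then show ?thesis using E(2) by (cases k) (simp_all add: Z_def)
qed

text \<open>Differentiability at 0 excludes the singular solutions, the negative power or the
  logarithm: the first integral becomes \<open>r * A1 r = k * A r\<close>, so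
  \<open>A r / r ^ k\<close> is constant.\<close>

lemma radial_ode_homogeneous:
  assumes A: "\<And>r. 0 \<le> r \<Longrightarrow> r \<le> \<rho> \<Longrightarrow> (A has_real_derivative A1 r) (at r)"
    and A1: "\<And>r. 0 \<le> r \<Longrightarrow> r \<le> \<rho> \<Longrightarrow> (A1 has_real_derivative A2 r) (at r)"
    and ode: "\<And>r. 0 \<le> r \<Longrightarrow> r \<le> \<rho> \<Longrightarrow> r\<^sup>2 * A2 r + r * A1 r - (real k)\<^sup>2 * A r = 0"
    and \<rho>: "\<rho> > 0"
  obtains c where "\<And>r. 0 \<le> r \<Longrightarrow> r \<le> \<rho> \<Longrightarrow> A r = c * r ^ k"
    and "\<rho> * A1 \<rho> = real k * A \<rho>"
proof -
  have eul: "r * A1 r = real k * A r" if r: "0 < r" "r \<le> \<rho>" for r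
  proof -
    have "r ^ Suc k * A1 r - real k * r ^ k * A r = 0"
      by (rule radial_ode_first_integral[where E="\<lambda>_. 0" and g="\<lambda>_. 0", OF A A1])
         (use ode r in auto)
    then have "r ^ k * (r * A1 r - real k * A r) = 0" by (simp add: algebra_simps)
    then show ?thesis using r by simp
  qed
  have cA: "continuous_on {0..\<rho>} A"
    by (intro continuous_at_imp_continuous_on ballI DERIV_isCont[OF A]) auto
  have main: "A r = A \<rho> / \<rho> ^ k * r ^ k" if r: "0 < r" "r \<le> \<rho>" for r
  proof (cases "r = \<rho>")
    case False
    define W where "W r = A r / r ^ k" for r
    have dW: "(W has_real_derivative 0) (at x)" if x: "0 < x" "x \<le> \<rho>" for x
    proof -
      have "(W has_real_derivative (A1 x * x ^ k - A x * (real k * x ^ (k - 1))) / (x ^ k * x ^ k)) (at x)"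
        unfolding W_def using x by (auto intro!: derivative_eq_intros A)
      moreover have "(A1 x * x ^ k - A x * (real k * x ^ (k - 1))) * x = x ^ k * (x * A1 x - real k * A x)"
        by (cases k) (simp_all add: algebra_simps)
      then have "A1 x * x ^ k - A x * (real k * x ^ (k - 1)) = 0" using eul[OF x] x by simp
      ultimately show ?thesis by simp
    qed
    have "W \<rho> = W r"
    proof (rule DERIV_isconst2[of r \<rho> W \<rho>])
      show "continuous_on {r..\<rho>} W"
        by (intro continuous_at_imp_continuous_on ballI DERIV_isCont[OF dW]) (use r in auto)
    qed (use r False dW in auto)
    then show ?thesis using r by (simp add: W_def field_simps)
  qed (use \<rho> in simp)
  \<comment> \<open>At the centre, \<open>k = 0\<close> uses continuity of \<open>A\<close>, and
    \<open>k > 0\<close> uses the equation itself, which at \<open>r = 0\<close> reads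
    \<open>k\<^sup>2 * A 0 = 0\<close>.\<close>
  have "A 0 = A \<rho> / \<rho> ^ k * 0 ^ k"
  proof (cases k)
    case 0
    have "A \<rho> = A 0"
    proof (rule DERIV_isconst2[of 0 \<rho> A \<rho>])
      show "(A has_real_derivative 0) (at x)" if "0 < x" "x < \<rho>" for x
        using A[of x] eul[of x] that 0 by simp
    qed (use \<rho> cA in auto)
    then show ?thesis using 0 by simp
  next
    case (Suc n)
    then show ?thesis using ode[of 0] \<rho> by simp
  qed
  then have "A r = A \<rho> / \<rho> ^ k * r ^ k" if "0 \<le> r" "r \<le> \<rho>" for r
    using main that by (metis less_eq_real_def)
  then show ?thesis using that eul[of \<rho>] \<rho> by blast
qed

text \<open>\<open>A\<close> and \<open>B\<close> play the Fourier coefficients of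
  \<open>\<Delta> u\<close> and \<open>u\<close>. Here \<open>A = c * r ^ k\<close>, and the first
  integral for \<open>B\<close> expresses \<open>B \<rho>\<close> through \<open>c\<close>; the
  boundary conditions then force \<open>c = 0\<close>, after which \<open>B\<close> solves the
  homogeneous equation as well.\<close>

lemma radial_steklov_trivial:
  assumes \<rho>: "0 < \<rho>" "\<rho> < 1"
    and A: "\<And>r. 0 \<le> r \<Longrightarrow> r \<le> \<rho> \<Longrightarrow> (A has_real_derivative A1 r) (at r)"
    and A1: "\<And>r. 0 \<le> r \<Longrightarrow> r \<le> \<rho> \<Longrightarrow> (A1 has_real_derivative A2 r) (at r)"
    and B: "\<And>r. 0 \<le> r \<Longrightarrow> r \<le> \<rho> \<Longrightarrow> (B has_real_derivative B1 r) (at r)"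
    and B1: "\<And>r. 0 \<le> r \<Longrightarrow> r \<le> \<rho> \<Longrightarrow> (B1 has_real_derivative B2 r) (at r)"
    and odeA: "\<And>r. 0 \<le> r \<Longrightarrow> r \<le> \<rho> \<Longrightarrow> r\<^sup>2 * A2 r + r * A1 r - (real k)\<^sup>2 * A r = 0"
    and odeB: "\<And>r. 0 \<le> r \<Longrightarrow> r \<le> \<rho> \<Longrightarrow>
      r\<^sup>2 * B2 r + r * B1 r - (real k)\<^sup>2 * B r = r\<^sup>2 * (4 / (1 - r\<^sup>2)\<^sup>2 * A r)"
    and bc: "B1 \<rho> = 0" "(1 - \<rho>\<^sup>2) / 2 * A1 \<rho> + \<xi> * B \<rho> = 0"
    and \<xi>: "\<xi> \<noteq> steklov_value k \<rho>"
    and r: "0 \<le> r" "r \<le> \<rho>"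
  shows "B r = 0"
proof -
  obtain c where c: "\<And>r. 0 \<le> r \<Longrightarrow> r \<le> \<rho> \<Longrightarrow> A r = c * r ^ k" and eA: "\<rho> * A1 \<rho> = real k * A \<rho>"
    using radial_ode_homogeneous[OF A A1 odeA \<rho>(1)] by blast
  have sq: "x\<^sup>2 < 1" if "0 \<le> x" "x \<le> \<rho>" for x
    using that \<rho> by (simp add: abs_square_less_1)
  \<comment> \<open>The antiderivative of
    \<open>4 * c * r ^ (2 * k + 1) / (1 - r\<^sup>2)\<^sup>2\<close>, found by substituting
    \<open>s = r\<^sup>2\<close> in the integral formula for \<open>q\<^sub>k\<close>.\<close>
  define E where "E r = 2 * c * ((r\<^sup>2) ^ Suc k * qser k (r\<^sup>2))" for r
  have dE: "(E has_real_derivative x ^ Suc k * (4 / (1 - x\<^sup>2)\<^sup>2 * A x)) (at x)" if x: "0 \<le> x" "x \<le> \<rho>" for x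
  proof -
    have n: "norm (x\<^sup>2) < 1" using sq[OF x] by simp
    have d2: "((\<lambda>x. x\<^sup>2) has_real_derivative 2 * x) (at x)"
      by (auto intro!: derivative_eq_intros)
    have "((\<lambda>s. s ^ Suc k * qser k s) has_real_derivative
        (real k + 1) * (x\<^sup>2) ^ k * qser k (x\<^sup>2) + (x\<^sup>2) ^ Suc k * qser' k (x\<^sup>2)) (at (x\<^sup>2))"
      by (rule DERIV_cong[OF DERIV_mult[OF DERIV_power[OF DERIV_ident] qser_has_derivative[OF n]]])
         (simp add: algebra_simps)
    from DERIV_cmult[OF DERIV_chain2[OF this d2], of "2 * c"]
    have "(E has_real_derivative 2 * c * (((real k + 1) * (x\<^sup>2) ^ k * qser k (x\<^sup>2)
        + (x\<^sup>2) ^ Suc k * qser' k (x\<^sup>2)) * (2 * x))) (at x)"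
      by (simp add: E_def[abs_def])
    moreover have "2 * c * (((real k + 1) * (x\<^sup>2) ^ k * qser k (x\<^sup>2)
        + (x\<^sup>2) ^ Suc k * qser' k (x\<^sup>2)) * (2 * x))
      = 4 * c * (x\<^sup>2) ^ k * x * (x\<^sup>2 * qser' k (x\<^sup>2) + (real k + 1) * qser k (x\<^sup>2))"
      by (simp add: algebra_simps)
    moreover have "\<dots> = x ^ Suc k * (4 / (1 - x\<^sup>2)\<^sup>2 * A x)"
      unfolding qser_ode[OF n] c[OF x]
      by (simp add: power2_eq_square power_mult_distrib)
    ultimately show ?thesis by simp
  qed
  have "\<rho> ^ Suc k * B1 \<rho> - real k * \<rho> ^ k * B \<rho> = E \<rho>"
    by (rule radial_ode_first_integral[OF B B1 odeB dE]) (use \<rho> in \<open>auto simp: E_def\<close>)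
  then have kB: "- (real k * \<rho> ^ k * B \<rho>) = 2 * c * ((\<rho>\<^sup>2) ^ Suc k * qser k (\<rho>\<^sup>2))"
    by (simp add: bc(1) E_def)
  have q: "qser k (\<rho>\<^sup>2) > 0" using qser_pos sq[of \<rho>] \<rho> by simp
  have c0: "c = 0"
  proof (rule ccontr)
    assume c0: "c \<noteq> 0"
    \<comment> \<open>The second boundary condition is multiplied by
      \<open>\<rho> * (k * \<rho> ^ k)\<close> so that \<open>eA\<close> and \<open>kB\<close> can
      be inserted.\<close>
    have "(1 - \<rho>\<^sup>2) / 2 * (\<rho> * A1 \<rho>) * (real k * \<rho> ^ k) = \<xi> * \<rho> * - (real k * \<rho> ^ k * B \<rho>)"
    proof -
      have "(1 - \<rho>\<^sup>2) / 2 * (\<rho> * A1 \<rho>) * (real k * \<rho> ^ k)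
          = ((1 - \<rho>\<^sup>2) / 2 * A1 \<rho> + \<xi> * B \<rho>) * \<rho> * (real k * \<rho> ^ k) + \<xi> * \<rho> * - (real k * \<rho> ^ k * B \<rho>)"
        by (simp add: algebra_simps)
      then show ?thesis unfolding bc(2) by simp
    qed
    then have "(1 - \<rho>\<^sup>2) / 2 * (real k)\<^sup>2 * (c * (\<rho> ^ k * \<rho> ^ k)) =
        \<xi> * (2 * \<rho> ^ 3 * qser k (\<rho>\<^sup>2)) * (c * (\<rho> ^ k * \<rho> ^ k))"
      unfolding kB eA c[OF less_imp_le[OF \<rho>(1)] order_refl]
      by (simp add: power2_eq_square power3_eq_cube power_mult_distrib mult.assoc mult.left_commute mult.commute)
    then have "(1 - \<rho>\<^sup>2) / 2 * (real k)\<^sup>2 = \<xi> * (2 * \<rho> ^ 3 * qser k (\<rho>\<^sup>2))"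
      using c0 \<rho> by simp
    then have "\<xi> = steklov_value k \<rho>"
      using q \<rho> by (simp add: steklov_value_def field_simps)
    then show False using \<xi> by simp
  qed
  have "r\<^sup>2 * B2 r + r * B1 r - (real k)\<^sup>2 * B r = 0" if "0 \<le> r" "r \<le> \<rho>" for r
    using odeB[OF that] c[OF that] c0 by simp
  from radial_ode_homogeneous[OF B B1 this \<rho>(1)] obtain d
    where d: "\<And>r. 0 \<le> r \<Longrightarrow> r \<le> \<rho> \<Longrightarrow> B r = d * r ^ k" and eB: "\<rho> * B1 \<rho> = real k * B \<rho>"
    by blast
  \<comment> \<open>In mode 0 the function \<open>B\<close> is constant and the Neumann condition is
    void; the other condition decides, because \<open>\<xi>\<close> differs from
    \<open>steklov_value 0 \<rho> = 0\<close>.\<close>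
  have "d = 0"
  proof (cases "k = 0")
    case True
    then have "A1 \<rho> = 0" using eA \<rho> by simp
    moreover have "\<xi> \<noteq> 0" using \<xi> True by (simp add: steklov_value_def)
    ultimately show ?thesis using bc(2) d[of \<rho>] \<rho> True by simp
  next
    case False
    then show ?thesis using eB bc(1) d[of \<rho>] \<rho> by simp
  qed
  then show ?thesis using d[OF r] by simp
qed

section \<open>The hyperbolic Laplacian\<close>

lemma eucl_laplacian_cong:
  assumes "open S" "x \<in> S" "\<And>y. y \<in> S \<Longrightarrow> f y = g y"
  shows "eucl_laplacian f x = eucl_laplacian g x"
  unfolding eucl_laplacian_def
  by (intro sum.cong refl pderiv_at_cong[OF assms(1,2)] pderiv_at_cong[OF assms(1)] assms(3))

text \<open>In dimension two \<open>sqrt (det G)\<close> is the conformal factor itself and cancels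
  the inverse metric in the gradient before anything is differentiated. Only the outer division by
  the factor remains.\<close>

lemma laplace_beltrami_hyp:
  assumes x: "norm x < 1"
  shows "laplace_beltrami hyp_metric f x = ((1 - x \<bullet> x) / 2)\<^sup>2 * eucl_laplacian f x"
proof -
  define c where "c x = (2 / (1 - (norm x)\<^sup>2))\<^sup>2" for x :: "real^2"
  have c: "c y > 0" if "norm y < 1" for y
    using that by (simp add: c_def abs_square_less_1 less_imp_neq abs_square_eq_1)
  have G: "hyp_metric y = mat (c y)" for y by (simp add: hyp_metric_def c_def)
  have det: "sqrt (det (hyp_metric y)) = c y" for y
  proof -
    have "det (hyp_metric y) = (c y)\<^sup>2" by (simp add: G det_2 mat_def power2_eq_square)
    moreover have "c y \<ge> 0" by (simp add: c_def)
    ultimately show ?thesis by simp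
  qed
  have inv: "matrix_inv (hyp_metric y) = mat (1 / c y)" if "norm y < 1" for y
  proof -
    have m: "mat a ** (mat b :: real^2^2) = mat (a * b)" for a b :: real
      by (simp add: matrix_matrix_mult_def mat_def vec_eq_iff forall_2 sum_2)
    define N where "N = matrix_inv (hyp_metric y)"
    have "invertible (hyp_metric y)"
      unfolding invertible_def G using c[OF that] by (intro exI[of _ "mat (1 / c y)"]) (simp add: m)
    then have "hyp_metric y ** N = mat 1" unfolding N_def invertible_def matrix_inv_def by (rule someI2_ex) simp
    then have "mat (1 / c y) ** (mat (c y) ** N) = mat (1 / c y)" by (simp add: G)
    then show ?thesis using c[OF that] by (simp add: matrix_mul_assoc m N_def)
  qed
  have mv: "mat a *v w = a *\<^sub>R w" for a :: real and w :: "real^2"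
    by (simp add: matrix_vector_mult_def mat_def vec_eq_iff forall_2 sum_2)
  have "pderiv_at i (\<lambda>y. sqrt (det (hyp_metric y)) * riem_grad hyp_metric f y $ i) x
      = pderiv_at i (pderiv_at i f) x" for i
  proof (rule pderiv_at_cong[of "ball 0 1"])
    fix y :: "real^2" assume "y \<in> ball 0 1"
    then have "norm y < 1" by simp
    from c[OF this] inv[OF this]
    show "sqrt (det (hyp_metric y)) * riem_grad hyp_metric f y $ i = pderiv_at i f y"
      by (simp add: det riem_grad_def mv)
  qed (use x in auto)
  then have "laplace_beltrami hyp_metric f x = eucl_laplacian f x / c x"
    by (simp add: laplace_beltrami_def riem_div_def det eucl_laplacian_def)
  then show ?thesis
    by (simp add: c_def power_divide power2_norm_eq_inner)
qed

lemma normal_deriv_cong: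
  assumes "open S" "x \<in> S" "\<And>y. y \<in> S \<Longrightarrow> f y = g y"
  shows "normal_deriv G M f x = normal_deriv G M g x"
  using frechet_derivative_cong_open[OF assms] by (simp add: normal_deriv_def)

lemma normal_deriv_hyp:
  assumes \<rho>: "0 < \<rho>" "\<rho> < 1" and x: "norm x = \<rho>" and f: "f differentiable (at x)"
  shows "normal_deriv hyp_metric (cball 0 \<rho>) f x
    = (1 - \<rho>\<^sup>2) / (2 * \<rho>) * (x $ 1 * pderiv_at 1 f x + x $ 2 * pderiv_at 2 f x)"
proof -
  have "outward_unit_normal hyp_metric (cball 0 \<rho>) x = ((1 - \<rho>\<^sup>2) / (2 * \<rho>)) *\<^sub>R x"
    unfolding outward_unit_normal_def outward_unit_normal_hyp[OF \<rho> x] by simp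
  then show ?thesis
    unfolding normal_deriv_def frechet_derivative_pderiv_at[OF f]
    by (simp add: sum_2 algebra_simps)
qed

section \<open>Separated eigenfunctions\<close>

text \<open>The real and imaginary parts of \<open>(x\<^sub>1 + i x\<^sub>2)\<^sup>k\<close>.\<close>

fun hre him :: "nat \<Rightarrow> real^2 \<Rightarrow> real" where
  "hre 0 x = 1"
| "him 0 x = 0"
| "hre (Suc k) x = x $ 1 * hre k x - x $ 2 * him k x"
| "him (Suc k) x = x $ 1 * him k x + x $ 2 * hre k x"

lemma Ck_on_hre_him:
  assumes "open S"
  shows "Ck_on n S (hre k) \<and> Ck_on n S (him k)"
proof (induction k)
  case 0
  have "hre 0 = (\<lambda>_. 1)" "him 0 = (\<lambda>_. 0)" by (simp_all add: fun_eq_iff)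
  then show ?case by (simp only: Ck_on_const simp_thms)
next
  case (Suc k)
  have "hre (Suc k) = (\<lambda>x. x $ 1 * hre k x - x $ 2 * him k x)"
    "him (Suc k) = (\<lambda>x. x $ 1 * him k x + x $ 2 * hre k x)" by (simp_all add: fun_eq_iff)
  then show ?case
    using Suc by (simp only:) (intro conjI Ck_on_add Ck_on_diff Ck_on_mult assms Ck_on_component; simp)
qed

lemma differentiable_hre_him: "hre k differentiable (at x)" "him k differentiable (at x)"
  using Ck_on_hre_him[of UNIV 1 k] by simp_all

lemma pderiv_at_hre_him_Suc:
  "pderiv_at i (hre (Suc k)) x = axis i 1 $ 1 * hre k x + x $ 1 * pderiv_at i (hre k) x
      - (axis i 1 $ 2 * him k x + x $ 2 * pderiv_at i (him k) x)"
  "pderiv_at i (him (Suc k)) x = axis i 1 $ 1 * him k x + x $ 1 * pderiv_at i (him k) x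
      + (axis i 1 $ 2 * hre k x + x $ 2 * pderiv_at i (hre k) x)"
proof -
  have e: "hre (Suc k) = (\<lambda>x. x $ 1 * hre k x - x $ 2 * him k x)"
    "him (Suc k) = (\<lambda>x. x $ 1 * him k x + x $ 2 * hre k x)" by (simp_all add: fun_eq_iff)
  note d = differentiable_component differentiable_hre_him differentiable_mult
  show "pderiv_at i (hre (Suc k)) x = axis i 1 $ 1 * hre k x + x $ 1 * pderiv_at i (hre k) x
      - (axis i 1 $ 2 * him k x + x $ 2 * pderiv_at i (him k) x)"
    unfolding e by (simp add: pderiv_at_diff pderiv_at_mult d)
  show "pderiv_at i (him (Suc k)) x = axis i 1 $ 1 * him k x + x $ 1 * pderiv_at i (him k) x
      + (axis i 1 $ 2 * hre k x + x $ 2 * pderiv_at i (hre k) x)"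
    unfolding e by (simp add: pderiv_at_add pderiv_at_mult d)
qed

text \<open>The Cauchy-Riemann equations together with the derivative of the \<open>k\<close>-th
  power. All four formulas are proved at once because the recursion mixes \<open>hre\<close> and
  \<open>him\<close>.\<close>

lemma pderiv_at_hre_him:
  "pderiv_at 1 (hre k) x = real k * hre (k - 1) x \<and> pderiv_at 2 (hre k) x = - real k * him (k - 1) x \<and>
   pderiv_at 1 (him k) x = real k * him (k - 1) x \<and> pderiv_at 2 (him k) x = real k * hre (k - 1) x"
proof (induction k)
  case 0
  have "hre 0 = (\<lambda>_. 1)" "him 0 = (\<lambda>_. 0)" by (simp_all add: fun_eq_iff)
  then show ?case by simp
next
  case (Suc k)
  \<comment> \<open>The factor \<open>real k\<close> makes the recursion valid also for
    \<open>k = 0\<close>, where \<open>k - 1\<close> is 0.\<close>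
  have p: "real k * hre k x = real k * (x $ 1 * hre (k - 1) x - x $ 2 * him (k - 1) x)"
    "real k * him k x = real k * (x $ 1 * him (k - 1) x + x $ 2 * hre (k - 1) x)"
    by (cases k; simp)+
  have a: "axis (1::2) (1::real) $ 2 = 0" "axis (2::2) (1::real) $ 1 = 0"
    "axis (1::2) (1::real) $ 1 = 1" "axis (2::2) (1::real) $ 2 = 1"
    by (simp_all add: axis_def)
  note IH = Suc[THEN conjunct1] Suc[THEN conjunct2, THEN conjunct1]
    Suc[THEN conjunct2, THEN conjunct2, THEN conjunct1] Suc[THEN conjunct2, THEN conjunct2, THEN conjunct2]
  show ?case
    unfolding pderiv_at_hre_him_Suc a IH diff_Suc_1 of_nat_Suc using p by (intro conjI; algebra)
qed

lemma hre_euler: "x $ 1 * pderiv_at 1 (hre k) x + x $ 2 * pderiv_at 2 (hre k) x = real k * hre k x"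
  by (cases k) (simp_all add: pderiv_at_hre_him algebra_simps)

lemma eucl_laplacian_hre: "eucl_laplacian (hre k) x = 0"
proof -
  have e: "pderiv_at 1 (hre k) = (\<lambda>x. real k * hre (k - 1) x)"
    "pderiv_at 2 (hre k) = (\<lambda>x. - real k * him (k - 1) x)"
    by (simp_all add: fun_eq_iff pderiv_at_hre_him)
  have "pderiv_at 1 (pderiv_at 1 (hre k)) x = real k * (real (k - 1) * hre (k - 1 - 1) x)"
    unfolding e by (subst pderiv_at_mult) (simp_all add: differentiable_hre_him pderiv_at_hre_him)
  moreover have "pderiv_at 2 (pderiv_at 2 (hre k)) x = - real k * (real (k - 1) * hre (k - 1 - 1) x)"
    unfolding e by (subst pderiv_at_mult) (simp_all add: differentiable_hre_him pderiv_at_hre_him)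
  ultimately show ?thesis by (simp add: eucl_laplacian_def sum_2)
qed

lemma hre_axis: "x $ 2 = 0 \<Longrightarrow> hre k x = (x $ 1) ^ k \<and> him k x = 0"
  by (induction k) simp_all

text \<open>In the plane the Laplacian of \<open>g (x \<bullet> x)\<close> is
  \<open>4 * (s * g2 + g1)\<close> with \<open>s = x \<bullet> x\<close>, and Euler's relation turns
  the cross term of the product rule into \<open>4 * \<kappa> * g1 * h\<close>.\<close>

lemma radial_times_homogeneous:
  fixes h :: "real^2 \<Rightarrow> real"
  assumes S: "open S" "x \<in> S"
    and g: "\<And>y. y \<in> S \<Longrightarrow> (g has_real_derivative g1 (y \<bullet> y)) (at (y \<bullet> y))"
    and g1: "(g1 has_real_derivative g2) (at (x \<bullet> x))"
    and h: "Ck_on 2 S h"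
    and euler: "x $ 1 * pderiv_at 1 h x + x $ 2 * pderiv_at 2 h x = \<kappa> * h x"
  shows "x $ 1 * pderiv_at 1 (\<lambda>x. g (x \<bullet> x) * h x) x + x $ 2 * pderiv_at 2 (\<lambda>x. g (x \<bullet> x) * h x) x
      = (2 * (x \<bullet> x) * g1 (x \<bullet> x) + \<kappa> * g (x \<bullet> x)) * h x"
    and "eucl_laplacian (\<lambda>x. g (x \<bullet> x) * h x) x
      = 4 * ((x \<bullet> x) * g2 + (\<kappa> + 1) * g1 (x \<bullet> x)) * h x + g (x \<bullet> x) * eucl_laplacian h x"
proof -
  have dh: "h differentiable (at y)" "pderiv_at i h differentiable (at y)" if "y \<in> S" for y i
    using h that by (simp_all add: numeral_2_eq_2)
  have dr: "(\<lambda>x. G (x \<bullet> x)) differentiable (at y)"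
    if "(G has_real_derivative G') (at (y \<bullet> y))" for G G' and y :: "real^2"
    using has_derivative_radial[OF that] unfolding differentiable_def by blast
  have p: "pderiv_at i (\<lambda>x. g (x \<bullet> x) * h x) y
      = g (y \<bullet> y) * pderiv_at i h y + g1 (y \<bullet> y) * (2 * y $ i) * h y" if "y \<in> S" for y i
    using pderiv_at_mult[OF dr[OF g[OF that]] dh(1)[OF that], of i] pderiv_at_radial[OF g[OF that], of i]
    by simp
  have xx: "x \<bullet> x = x $ 1 * x $ 1 + x $ 2 * x $ 2" by (simp add: inner_vec_def sum_2)
  show "x $ 1 * pderiv_at 1 (\<lambda>x. g (x \<bullet> x) * h x) x + x $ 2 * pderiv_at 2 (\<lambda>x. g (x \<bullet> x) * h x) x
      = (2 * (x \<bullet> x) * g1 (x \<bullet> x) + \<kappa> * g (x \<bullet> x)) * h x"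
    unfolding p[OF S(2)] using euler xx by algebra
  have "pderiv_at i (pderiv_at i (\<lambda>x. g (x \<bullet> x) * h x)) x
      = g (x \<bullet> x) * pderiv_at i (pderiv_at i h) x + g1 (x \<bullet> x) * (2 * x $ i) * pderiv_at i h x
        + (g1 (x \<bullet> x) * (2 * x $ i) * pderiv_at i h x
           + (g1 (x \<bullet> x) * 2 + g2 * (2 * x $ i) * (2 * x $ i)) * h x)" for i
  proof -
    have d1: "(\<lambda>x. g1 (x \<bullet> x)) differentiable (at x)" by (rule dr[OF g1])
    have d0: "(\<lambda>x. g (x \<bullet> x)) differentiable (at x)" by (rule dr[OF g[OF S(2)]])
    have dx: "(\<lambda>x. 2 * x $ i) differentiable (at x)"
      by (intro differentiable_mult differentiable_component differentiable_const)
    have px: "pderiv_at i (\<lambda>x. 2 * x $ i) x = 2"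
      by (subst pderiv_at_mult) (simp_all add: differentiable_component axis_def)
    have "pderiv_at i (pderiv_at i (\<lambda>x. g (x \<bullet> x) * h x)) x
        = pderiv_at i (\<lambda>y. g (y \<bullet> y) * pderiv_at i h y + g1 (y \<bullet> y) * (2 * y $ i) * h y) x"
      by (rule pderiv_at_cong[OF S]) (rule p)
    also have "\<dots> = pderiv_at i (\<lambda>y. g (y \<bullet> y) * pderiv_at i h y) x
        + pderiv_at i (\<lambda>y. g1 (y \<bullet> y) * (2 * y $ i) * h y) x"
      by (intro pderiv_at_add differentiable_mult d0 d1 dx dh S)
    also have "pderiv_at i (\<lambda>y. g (y \<bullet> y) * pderiv_at i h y) x
        = g (x \<bullet> x) * pderiv_at i (pderiv_at i h) x + g1 (x \<bullet> x) * (2 * x $ i) * pderiv_at i h x"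
      unfolding pderiv_at_mult[OF d0 dh(2)[OF S(2)]] pderiv_at_radial[OF g[OF S(2)]] ..
    also have "pderiv_at i (\<lambda>y. g1 (y \<bullet> y) * (2 * y $ i) * h y) x
        = g1 (x \<bullet> x) * (2 * x $ i) * pderiv_at i h x
           + (g1 (x \<bullet> x) * 2 + g2 * (2 * x $ i) * (2 * x $ i)) * h x"
      unfolding pderiv_at_mult[OF differentiable_mult[OF d1 dx] dh(1)[OF S(2)]]
        pderiv_at_mult[OF d1 dx] px pderiv_at_radial[OF g1] ..
    finally show ?thesis .
  qed
  note pp = this
  show "eucl_laplacian (\<lambda>x. g (x \<bullet> x) * h x) x
      = 4 * ((x \<bullet> x) * g2 + (\<kappa> + 1) * g1 (x \<bullet> x)) * h x + g (x \<bullet> x) * eucl_laplacian h x"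
    unfolding eucl_laplacian_def sum_2 pp using euler xx by algebra
qed

text \<open>Constants serve for \<open>k = 0\<close>. Otherwise
  \<open>u = g (x \<bullet> x) * hre k x\<close> with \<open>g' = q\<^sub>k\<close>, and
  \<open>qser_ode\<close> makes its Laplacian exactly \<open>hre k\<close>. A constant added to
  \<open>g\<close> leaves the Laplacian unchanged, since \<open>hre k\<close> is harmonic.\<close>

lemma steklov_value_is_eigenvalue:
  assumes \<rho>: "0 < \<rho>" "\<rho> < 1"
  shows "steklov_eigenvalue hyp_metric (cball 0 \<rho>) (steklov_value k \<rho>)"
proof (cases "k = 0")
  case True
  have lb: "laplace_beltrami hyp_metric (\<lambda>_. c) = (\<lambda>_. 0)" for c
    by (simp add: fun_eq_iff laplace_beltrami_def riem_grad_def[abs_def] riem_div_def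
        matrix_vector_mult_def)
  have nd: "normal_deriv hyp_metric (cball 0 \<rho>) (\<lambda>_. c) x = 0" for c x
    by (simp add: normal_deriv_def frechet_derivative_const)
  have "smooth_on UNIV (\<lambda>_::real^2. 1)" by (simp add: smooth_on_def Ck_on_const)
  then show ?thesis
    unfolding steklov_eigenvalue_def using \<rho> True
    by (intro exI[of _ "\<lambda>_. 1"] exI[of _ UNIV]) (auto simp: lb nd steklov_value_def intro!: exI[of _ "0 :: real^2"])
next
  case False
  \<comment> \<open>The coefficients of the antiderivative of \<open>q\<^sub>k\<close> that vanishes
    at 0.\<close>
  define c :: "nat \<Rightarrow> real" where "c j = (if j = 0 then 0 else 1 / (real k + real j))" for j
  define T where "T n s = (\<Sum>j. (diffs ^^ n) c j * s ^ j)" for n s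
  have cb: "\<bar>c j\<bar> \<le> 1" for j by (simp add: c_def)
  have dT: "(T n has_real_derivative T (Suc n) s) (at s)" if "norm s < 1" for n s
    unfolding T_def[abs_def]
    by (rule powser_tower_has_derivative[OF summable_bounded_coeffs[OF cb] that])
  have "diffs c = qcoeff k"
    by (simp add: fun_eq_iff diffs_def c_def qcoeff_def add.commute add.left_commute)
  then have T1: "T (Suc 0) s = qser k s" for s
    by (simp add: T_def qser_def)
  define s where "s = \<rho>\<^sup>2"
  have s: "0 < s" "s < 1" using \<rho> by (auto simp: s_def abs_square_less_1)
  \<comment> \<open>The additive constant is chosen to satisfy
    \<open>2 * s * qser k s + k * g s = 0\<close>, which is the condition that the normal derivative
    of \<open>u\<close> vanishes on the boundary.\<close>
  define g where "g t = (- 2 * s * qser k s / real k - T 0 s) + T 0 t" for t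
  define u where "u x = g (x \<bullet> x) * hre k x" for x
  define D :: "(real^2) set" where "D = ball 0 1"
  have D: "open D" "cball 0 \<rho> \<subseteq> D" using \<rho> by (auto simp: D_def)
  have nD: "norm (x \<bullet> x) < 1" if "x \<in> D" for x
    using that by (simp add: D_def flip: power2_norm_eq_inner) (simp add: abs_square_less_1)
  have g: "(g has_real_derivative qser k t) (at t)" if "norm t < 1" for t
    unfolding g_def[abs_def] using DERIV_add[OF DERIV_const dT[OF that, of 0]] by (simp add: T1)
  have smooth: "Ck_on n D u" for n
  proof -
    have "Ck_on n D (\<lambda>x. T 0 (x \<bullet> x))"
      by (rule Ck_on_radial[OF D(1)]) (rule dT[OF nD])
    then show ?thesis
      unfolding u_def[abs_def] g_def
      using Ck_on_hre_him[OF D(1)] by (intro Ck_on_mult Ck_on_add Ck_on_const D(1)) auto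
  qed
  have rad: "x $ 1 * pderiv_at 1 u x + x $ 2 * pderiv_at 2 u x
      = (2 * (x \<bullet> x) * qser k (x \<bullet> x) + real k * g (x \<bullet> x)) * hre k x"
    and lapu: "eucl_laplacian u x
      = 4 * ((x \<bullet> x) * qser' k (x \<bullet> x) + (real k + 1) * qser k (x \<bullet> x)) * hre k x"
    if x: "x \<in> D" for x
  proof -
    have *: "Ck_on 2 D (hre k)" using Ck_on_hre_him[OF D(1)] by blast
    show "x $ 1 * pderiv_at 1 u x + x $ 2 * pderiv_at 2 u x
      = (2 * (x \<bullet> x) * qser k (x \<bullet> x) + real k * g (x \<bullet> x)) * hre k x"
      unfolding u_def[abs_def]
      by (rule radial_times_homogeneous(1)[OF D(1) x g[OF nD] qser_has_derivative[OF nD[OF x]] * hre_euler])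
    show "eucl_laplacian u x
      = 4 * ((x \<bullet> x) * qser' k (x \<bullet> x) + (real k + 1) * qser k (x \<bullet> x)) * hre k x"
      using radial_times_homogeneous(2)[OF D(1) x g[OF nD] qser_has_derivative[OF nD[OF x]] * hre_euler]
      by (simp add: u_def[abs_def] eucl_laplacian_hre)
  qed
  have lb: "laplace_beltrami hyp_metric u x = hre k x" if x: "x \<in> D" for x
  proof -
    have "1 - x \<bullet> x \<noteq> 0" using nD[OF x] by simp
    then show ?thesis
      using x laplace_beltrami_hyp[of x u]
      unfolding lapu[OF x] qser_ode[OF nD[OF x]] by (simp add: D_def power_divide)
  qed
  have "laplace_beltrami hyp_metric (laplace_beltrami hyp_metric u) x = 0" if x: "x \<in> D" for x
    using laplace_beltrami_hyp[of x "laplace_beltrami hyp_metric u"] x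
      eucl_laplacian_cong[OF D(1) x lb] by (simp add: eucl_laplacian_hre D_def)
  moreover
  have gs: "g s = - 2 * s * qser k s / real k" by (simp add: g_def)
  have bd: "normal_deriv hyp_metric (cball 0 \<rho>) u x = 0 \<and>
      normal_deriv hyp_metric (cball 0 \<rho>) (laplace_beltrami hyp_metric u) x + steklov_value k \<rho> * u x = 0"
    if x: "x \<in> frontier (cball 0 \<rho>)" for x
  proof -
    have xn: "norm x = \<rho>" using x \<rho> by (simp add: frontier_cball)
    have xx: "x \<bullet> x = s" using xn by (simp add: s_def flip: power2_norm_eq_inner)
    have xD: "x \<in> D" using xn \<rho> by (simp add: D_def)
    have "u differentiable (at x)" using smooth[of 1] xD by simp
    then have 1: "normal_deriv hyp_metric (cball 0 \<rho>) u x = 0"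
      using False by (simp add: normal_deriv_hyp[OF \<rho> xn] rad[OF xD] xx gs)
    have "normal_deriv hyp_metric (cball 0 \<rho>) (laplace_beltrami hyp_metric u) x
        = normal_deriv hyp_metric (cball 0 \<rho>) (hre k) x"
      by (rule normal_deriv_cong[OF D(1) xD]) (rule lb)
    then have "normal_deriv hyp_metric (cball 0 \<rho>) (laplace_beltrami hyp_metric u) x
        = (1 - s) / (2 * \<rho>) * (real k * hre k x)"
      by (simp add: normal_deriv_hyp[OF \<rho> xn differentiable_hre_him(1)] hre_euler s_def)
    moreover have "steklov_value k \<rho> * u x = - ((1 - s) / (2 * \<rho>) * (real k * hre k x))"
      using qser_pos[OF s, of k] \<rho> False
      by (simp add: steklov_value_def u_def xx gs) (simp add: s_def field_simps power2_eq_square power3_eq_cube)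
    ultimately show ?thesis using 1 by simp
  qed
  moreover have "\<exists>x\<in>cball 0 \<rho>. u x \<noteq> 0"
  proof (rule bexI)
    have "polar \<rho> 0 \<bullet> polar \<rho> 0 = s" by (simp add: s_def)
    then show "u (polar \<rho> 0) \<noteq> 0"
      using hre_axis[of "polar \<rho> 0" k] qser_pos[OF s, of k] \<rho> s False
      by (simp add: u_def gs)
  qed (use \<rho> in simp)
  ultimately show ?thesis
    unfolding steklov_eigenvalue_def smooth_on_def using D smooth
    by (intro exI[of _ u] exI[of _ D]) (auto simp: subset_iff)
qed

section \<open>Completeness of the separated eigenfunctions\<close>

text \<open>Only values on one circle matter, so \<open>c\<close> may depend on \<open>r\<close>, as
  the conformal factor does.\<close>

lemma fcoef_cong:
  assumes "\<And>x. norm x = \<bar>r\<bar> \<Longrightarrow> f x = c * g x"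
  shows "fcoef w f r = c * fcoef w g r"
  unfolding fcoef_def
  by (subst integral_mult_right[symmetric], rule integral_cong) (simp add: assms)

text \<open>Transfers boundary conditions to Fourier coefficients: the right side contains the same
  combination of partial derivatives as \<open>normal_deriv_hyp\<close>.\<close>

lemma fcoef1_eq:
  assumes w: "continuous_on UNIV w" and f: "Ck_on 1 (ball 0 \<rho>) f" and r: "\<bar>r\<bar> < \<rho>" "r \<noteq> 0"
  shows "fcoef1 w f r = fcoef w (\<lambda>x. (x $ 1 * pderiv_at 1 f x + x $ 2 * pderiv_at 2 f x) / r) r"
proof -
  have c: "continuous_on (ball 0 \<rho>) (pderiv_at i f)" for i using f by simp
  have "((\<lambda>t. w t * cos t * pderiv_at 1 f (polar r t) + w t * sin t * pderiv_at 2 f (polar r t))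
      has_integral fcoef1 w f r) {0..2 * pi}"
    unfolding fcoef1_def
    by (intro has_integral_add fcoef_has_integral[OF _ c r(1)] continuous_intros w)
  moreover have "w t * cos t * pderiv_at 1 f (polar r t) + w t * sin t * pderiv_at 2 f (polar r t)
      = w t * ((polar r t $ 1 * pderiv_at 1 f (polar r t) + polar r t $ 2 * pderiv_at 2 f (polar r t)) / r)" for t
    using r(2) by (simp add: field_simps)
  ultimately have "((\<lambda>t. w t * ((polar r t $ 1 * pderiv_at 1 f (polar r t)
      + polar r t $ 2 * pderiv_at 2 f (polar r t)) / r)) has_integral fcoef1 w f r) {0..2 * pi}"
    by (simp only:)
  then show ?thesis unfolding fcoef_def by (rule integral_unique[symmetric])
qed

text \<open>Provides a concentric open ball beyond the disk on which an eigenfunction is smooth;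
  \<open>\<sigma> = 1\<close> keeps it inside the hyperbolic plane.\<close>

lemma cball_subset_open_obtains_ball:
  fixes U :: "'a::euclidean_space set"
  assumes "open U" "cball 0 \<rho> \<subseteq> U" "0 < \<rho>" "\<rho> < \<sigma>"
  obtains \<tau> where "\<rho> < \<tau>" "\<tau> \<le> \<sigma>" "ball 0 \<tau> \<subseteq> U"
proof -
  obtain e where e: "e > 0" "(\<Union>x\<in>cball 0 \<rho>. ball x e) \<subseteq> U"
    using compact_subset_open_imp_ball_epsilon_subset[OF compact_cball assms(1,2)] by blast
  have "ball 0 (\<rho> + e) \<subseteq> U"
  proof
    fix y :: 'a assume y: "y \<in> ball 0 (\<rho> + e)"
    show "y \<in> U"
    proof (cases "norm y \<le> \<rho>")
      case True
      then show ?thesis using assms(2) by auto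
    next
      case False
      \<comment> \<open>The radial projection of \<open>y\<close> to the sphere of radius
        \<open>\<rho>\<close>, at distance \<open>norm y - \<rho> < e\<close>.\<close>
      define x where "x = (\<rho> / norm y) *\<^sub>R y"
      have n0: "norm y > 0" using False assms(3) by linarith
      have "y - x = (1 - \<rho> / norm y) *\<^sub>R y" by (simp add: x_def algebra_simps)
      then have "dist x y = \<bar>1 - \<rho> / norm y\<bar> * norm y"
        by (metis dist_commute dist_norm norm_scaleR)
      also have "\<dots> = norm y - \<rho>" using False n0 by (simp add: field_simps abs_if)
      also have "\<dots> < e" using y by simp
      finally have "y \<in> ball x e" by simp
      moreover have "x \<in> cball 0 \<rho>" using assms(3) n0 by (simp add: x_def)
      ultimately show ?thesis using e(2) by blast
    qed
  qed
  then show ?thesis using that[of "min \<sigma> (\<rho> + e)"] assms(4) e(1) by (auto simp: subset_iff)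
qed

lemma eigenvalue_is_steklov_value:
  assumes \<rho>: "0 < \<rho>" "\<rho> < 1" and ev: "steklov_eigenvalue hyp_metric (cball 0 \<rho>) \<xi>"
  shows "\<exists>k. \<xi> = steklov_value k \<rho>"
proof (rule ccontr)
  assume "\<nexists>k. \<xi> = steklov_value k \<rho>"
  then have \<xi>: "\<xi> \<noteq> steklov_value k \<rho>" for k by blast
  let ?L = "laplace_beltrami hyp_metric"
  obtain u U where U: "open U" "cball 0 \<rho> \<subseteq> U" "smooth_on U u"
    and nz: "\<exists>x\<in>cball 0 \<rho>. u x \<noteq> 0"
    and bih: "\<And>x. x \<in> cball 0 \<rho> \<Longrightarrow> ?L (?L u) x = 0"
    and bc1: "\<And>x. x \<in> frontier (cball 0 \<rho>) \<Longrightarrow> normal_deriv hyp_metric (cball 0 \<rho>) u x = 0"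
    and bc2: "\<And>x. x \<in> frontier (cball 0 \<rho>) \<Longrightarrow>
      normal_deriv hyp_metric (cball 0 \<rho>) (?L u) x + \<xi> * u x = 0"
    using ev unfolding steklov_eigenvalue_def by metis
  obtain \<tau> where \<tau>: "\<rho> < \<tau>" "\<tau> \<le> 1" "ball 0 \<tau> \<subseteq> U"
    using cball_subset_open_obtains_ball[OF U(1,2) \<rho>] by blast
  define D :: "(real^2) set" where "D = ball 0 \<tau>"
  have oD: "open D" by (simp add: D_def)
  have cu: "Ck_on n D u" for n
    using U(3) \<tau>(3) Ck_on_subset[of n U u D] by (simp add: smooth_on_def D_def)
  \<comment> \<open>Class 4 for \<open>u\<close> leaves class 2 for \<open>v\<close>, which is built
    from second derivatives of \<open>u\<close>.\<close>
  have pp: "Ck_on 2 D (pderiv_at i (pderiv_at i u))" for i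
    using cu[of 4] by (simp add: eval_nat_numeral)
  define v where "v x = ((1 - x \<bullet> x) / 2)\<^sup>2 * eucl_laplacian u x" for x
  have Lu: "?L u x = v x" if "x \<in> D" for x
    using that \<tau> by (simp add: v_def laplace_beltrami_hyp D_def)
  have cv: "Ck_on 2 D v"
  proof -
    have e: "v = (\<lambda>x. 1 / 4 * ((1 - (x $ 1 * x $ 1 + x $ 2 * x $ 2)) * (1 - (x $ 1 * x $ 1 + x $ 2 * x $ 2)))
        * (pderiv_at 1 (pderiv_at 1 u) x + pderiv_at 2 (pderiv_at 2 u) x))"
      by (simp add: fun_eq_iff v_def eucl_laplacian_def sum_2 inner_vec_def power2_eq_square)
    show ?thesis
      unfolding e by (intro Ck_on_mult Ck_on_add Ck_on_diff Ck_on_const Ck_on_component oD pp)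
  qed
  have sq: "x \<bullet> x < 1" if "norm x \<le> \<rho>" for x :: "real^2"
    using that \<rho> by (simp add: abs_square_less_1 flip: power2_norm_eq_inner)
  have lapv: "eucl_laplacian v x = 0" if x: "norm x \<le> \<rho>" for x
  proof -
    have xD: "x \<in> D" using x \<tau> by (simp add: D_def)
    \<comment> \<open>The identity \<open>Lu\<close> may be differentiated because it holds on the
      open set \<open>D\<close>, whereas the biharmonic equation is given on the closed disk
      only.\<close>
    have "?L (?L u) x = ((1 - x \<bullet> x) / 2)\<^sup>2 * eucl_laplacian v x"
      using laplace_beltrami_hyp[of x "?L u"] x \<rho> eucl_laplacian_cong[OF oD xD Lu] by simp
    then show ?thesis using bih[of x] x sq[OF x] by simp
  qed
  have lapu: "eucl_laplacian u x = 4 / (1 - r\<^sup>2)\<^sup>2 * v x" if "norm x = \<bar>r\<bar>" "\<bar>r\<bar> \<le> \<rho>" for x r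
  proof -
    have "x \<bullet> x = r\<^sup>2" using that(1) by (simp flip: power2_norm_eq_inner)
    moreover have "x \<bullet> x < 1" using sq[of x] that by simp
    ultimately show ?thesis by (simp add: v_def power_divide)
  qed
  have fr: "x \<in> frontier (cball 0 \<rho>)" "x \<in> D" if "norm x = \<rho>" for x :: "real^2"
    using that \<rho> \<tau> by (simp_all add: frontier_cball D_def)
  have ru: "x $ 1 * pderiv_at 1 u x + x $ 2 * pderiv_at 2 u x = 0" if x: "norm x = \<rho>" for x
  proof -
    have "u differentiable (at x)" using cu[of 1] fr[OF x] by simp
    then show ?thesis
      using bc1[OF fr(1)[OF x]] normal_deriv_hyp[OF \<rho> x] sq[of x] \<rho> x
      by (simp add: abs_square_eq_1)
  qed
  have rv: "(x $ 1 * pderiv_at 1 v x + x $ 2 * pderiv_at 2 v x) / \<rho> = - (2 * \<xi> / (1 - \<rho>\<^sup>2)) * u x"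
    if x: "norm x = \<rho>" for x
  proof -
    have "v differentiable (at x)" using cv fr[OF x] by (simp add: numeral_2_eq_2)
    from normal_deriv_hyp[OF \<rho> x this] have "(1 - \<rho>\<^sup>2) / (2 * \<rho>) * (x $ 1 * pderiv_at 1 v x + x $ 2 * pderiv_at 2 v x) + \<xi> * u x = 0"
      using bc2[OF fr(1)[OF x]] normal_deriv_cong[OF oD fr(2)[OF x] Lu] by simp
    moreover have "1 - \<rho>\<^sup>2 > 0" using \<rho> by (simp add: abs_square_less_1)
    ultimately show ?thesis using \<rho> by (simp add: field_simps)
  qed
  \<comment> \<open>Covers the weights \<open>cos (k * t)\<close> and \<open>sin (k * t)\<close>
    together: the second derivative of \<open>w\<close> is \<open>- k\<^sup>2 * w\<close>, and
    \<open>w\<close> and \<open>w1\<close> agree at 0 and \<open>2 * pi\<close>.\<close>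
  have zero: "fcoef w u r = 0"
    if w: "\<And>t. (w has_real_derivative w1 t) (at t)"
      "\<And>t. (w1 has_real_derivative - ((real k)\<^sup>2 * w t)) (at t)"
      and per: "w (2 * pi) = w 0" "w1 (2 * pi) = w1 0"
      and r: "0 \<le> r" "r \<le> \<rho>" for w w1 k r
  proof (rule radial_steklov_trivial[OF \<rho> _ _ _ _ _ _ _ _ \<xi> r])
    have wc: "continuous_on UNIV w"
      using w(1) by (meson DERIV_isCont continuous_at_imp_continuous_on)
    have c1: "Ck_on 1 (ball 0 \<tau>) v" using Ck_on_SucD[of 1 D v] cv by (simp add: D_def numeral_2_eq_2)
    have cD: "Ck_on n (ball 0 \<tau>) u" "Ck_on 2 (ball 0 \<tau>) v" for n using cu cv by (simp_all add: D_def)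
    show "(fcoef w v has_real_derivative fcoef1 w v x) (at x)"
      "(fcoef1 w v has_real_derivative fcoef2 w v x) (at x)"
      "(fcoef w u has_real_derivative fcoef1 w u x) (at x)"
      "(fcoef1 w u has_real_derivative fcoef2 w u x) (at x)" if "0 \<le> x" "x \<le> \<rho>" for x
      using that \<tau>(1)
      by (auto intro!: fcoef_has_derivative[OF wc c1] fcoef_has_derivative[OF wc cD(1)]
          fcoef1_has_derivative[OF wc cD(1)] fcoef1_has_derivative[OF wc cD(2)])
    show "x\<^sup>2 * fcoef2 w v x + x * fcoef1 w v x - (real k)\<^sup>2 * fcoef w v x = 0" if x: "0 \<le> x" "x \<le> \<rho>" for x
    proof -
      have "fcoef w (eucl_laplacian v) x = 0 * fcoef w v x"
        by (rule fcoef_cong) (use lapv x in simp)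
      then show ?thesis using fcoef_ode[OF w per cD(2), of x] x \<tau>(1) by simp
    qed
    show "x\<^sup>2 * fcoef2 w u x + x * fcoef1 w u x - (real k)\<^sup>2 * fcoef w u x
        = x\<^sup>2 * (4 / (1 - x\<^sup>2)\<^sup>2 * fcoef w v x)" if x: "0 \<le> x" "x \<le> \<rho>" for x
    proof -
      have "fcoef w (eucl_laplacian u) x = 4 / (1 - x\<^sup>2)\<^sup>2 * fcoef w v x"
        by (rule fcoef_cong) (use lapu x in simp)
      then show ?thesis using fcoef_ode[OF w per cD(1), of x] x \<tau>(1) by simp
    qed
    have \<rho>\<tau>: "\<bar>\<rho>\<bar> < \<tau>" "\<rho> \<noteq> 0" using \<rho> \<tau> by auto
    show "fcoef1 w u \<rho> = 0"
      unfolding fcoef1_eq[OF wc cD(1) \<rho>\<tau>] using fcoef_cong[of \<rho> _ 0 u w] ru \<rho> by simp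
    have "fcoef1 w v \<rho> = - (2 * \<xi> / (1 - \<rho>\<^sup>2)) * fcoef w u \<rho>"
      unfolding fcoef1_eq[OF wc c1 \<rho>\<tau>] by (rule fcoef_cong) (use rv \<rho> in simp)
    moreover have "1 - \<rho>\<^sup>2 > 0" using \<rho> by (simp add: abs_square_less_1)
    ultimately show "(1 - \<rho>\<^sup>2) / 2 * fcoef1 w v \<rho> + \<xi> * fcoef w u \<rho> = 0" by simp
  qed
  have per: "cos (real k * (2 * pi)) = 1" "sin (real k * (2 * pi)) = 0" for k
    using cos_int_2pin[of "int k"] sin_int_2pin[of "int k"] by (simp_all add: mult.commute mult.left_commute)
  have "u x = 0" if x: "norm x \<le> \<rho>" for x
  proof (rule fourier_uniqueness[OF _ norm_ge_zero _ _ refl])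
    have "continuous_on D u" using cu[of 0] by simp
    then show "continuous_on (sphere 0 (norm x)) u"
      by (rule continuous_on_subset) (use x \<tau> in \<open>auto simp: D_def\<close>)
    show "fcoef (\<lambda>t. cos (real k * t)) u (norm x) = 0" for k
      by (rule zero[where ?w1.0="\<lambda>t. - (real k * sin (real k * t))" and k=k])
        (auto intro!: derivative_eq_intros simp: x per power2_eq_square)
    show "fcoef (\<lambda>t. sin (real k * t)) u (norm x) = 0" for k
      by (rule zero[where ?w1.0="\<lambda>t. real k * cos (real k * t)" and k=k])
        (auto intro!: derivative_eq_intros simp: x per power2_eq_square)
  qed
  then show False using nz by auto
qed

lemma steklov_eigenvalue_hyp_iff:
  assumes "0 < \<rho>" "\<rho> < 1"
  shows "steklov_eigenvalue hyp_metric (cball 0 \<rho>) \<xi> \<longleftrightarrow> \<xi> \<in> range (\<lambda>k. steklov_value k \<rho>)"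
  using eigenvalue_is_steklov_value[OF assms] steklov_value_is_eigenvalue[OF assms] by auto

text \<open>Exactly the \<open>k\<close> values with smaller index lie below \<open>val k\<close>,
  so the count of smaller eigenvalues determines the index.\<close>

lemma nth_steklov_eigenvalue_eq:
  assumes ev: "\<And>\<xi>. steklov_eigenvalue G M \<xi> \<longleftrightarrow> \<xi> \<in> range val" and mono: "strict_mono val"
  shows "nth_steklov_eigenvalue G M m = val m"
proof -
  have "{\<eta>. steklov_eigenvalue G M \<eta> \<and> \<eta> < val k} = val ` {..<k}" for k
    using mono by (auto simp: ev strict_mono_less)
  moreover have "card (val ` {..<k}) = k" for k
    using strict_mono_imp_inj_on[OF mono] by (simp add: card_image inj_on_subset)
  ultimately show ?thesis
    unfolding nth_steklov_eigenvalue_def by (intro the_equality) (auto simp: ev)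
qed

lemma xi_eq_steklov_value:
  assumes "R > 0"
  shows "xi m R = steklov_value m (tanh (R / 2))"
  unfolding xi_def hyp_disk_eq[OF assms]
  using tanh_half_facts(1,2)[OF assms]
  by (intro nth_steklov_eigenvalue_eq steklov_eigenvalue_hyp_iff steklov_value_strict_mono_index)

theorem theorem7:
  fixes m :: nat
  assumes "m \<ge> 1"
  shows "strict_antimono_on {0<..} (\<lambda>R. xi m R * R ^ 3) \<and>
         strict_mono_on {0<..} (\<lambda>R. xi m R * sinh R ^ 3) \<and>
         strict_antimono_on {0<..} (\<lambda>R. xi m R * tanh (R / 2) ^ 3) \<and>
         strict_antimono_on {0<..} (\<lambda>R. xi m R * sinh (R / 2) ^ 3)"
  using assms xi_eq_steklov_value by (rule steklov_value_monotonicity)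

end
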